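(* Let $F=\frac1n\sum_{i=1}^nF_i$ where each $F_i:\mathbb{R}^d\to\mathbb{R}^d$ is $L$-Lipschitz ($L>0$), and let $F$ be monotone. Run DecPolyakSEG with $\gamma_{-1}>0$, $c_{-1}=1$, $c_k=\sqrt{k+1}$ for $k\ge 0$, and $\gamma_k>0$ satisfying, for all $k\ge 0$, $\gamma_k\le\frac{c_{k-1}}{c_k}\gamma_{k-1}$ and the stochastic critical condition $$\|F_{\mathcal S_k}(\hat x_k)-F_{\mathcal S_k}(x_k)\|\le A\|F_{\mathcal S_k}(x_k)\|$$ with a fixed $A\in(0,1)$. Assume there is a compact convex set $\mathcal C\subseteq\mathbb{R}^d$ with diameter $D$, containing a zero $x_*$ of $F$ (i.e. $F(x_* )=0$), such that $x_k,\hat x_k\in\mathcal C$ throughout the run of DecPolyakSEG. Then, for every $K\ge 0$, $\overline x_K:=\frac1{K+1}\sum_{k=0}^K\hat x_k$ satisfies $$\mathbb{E}\left[\|F(\overline x_K)\|^2\right]\le 4L\left[\frac1{K+1}\mathbb{E}\left[\frac{9D^2}{8\alpha_K}\right]+\frac{3\sigma D}{2\sqrt{K+1}}+\frac{2\gamma_{-1}}{(1-A)\sqrt{K+1}}\left(\sigma^2+9L^2D^2\right)\right],$$ where $\sigma\ge0$ is given by $\sigma^2=2L^2D^2+2\,\mathbb{E}_{\mathcal S}\left[\|F_{\mathcal S}(x_* )\|^2\right]$.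
   Context: $\langle\cdot,\cdot\rangle$ and $\|\cdot\|$ are Euclidean; $[n]=\{1,\dots,n\}$. $G$ is monotone if $\langle G(x)-G(y),x-y\rangle\ge 0$ for all $x,y$; $G$ is $L$-Lipschitz if $\|G(x)-G(y)\|\le L\|x-y\|$ for all $x,y$. For a mini-batch $\mathcal S$ of indices from $[n]$, $F_{\mathcal S}=\frac1{|\mathcal S|}\sum_{i\in\mathcal S}F_i$. At each iteration $k$ a mini-batch $\mathcal S_k$ is drawn from $[n]$ uniformly with replacement, independently of the past and with the same distribution for all $k$, so that $\mathbb{E}_{\mathcal S}[F_{\mathcal S}(x)]=F(x)$; $\mathbb{E}_{\mathcal S}$ is expectation over a mini-batch with this distribution. The step-size $\gamma_k$ may depend on the past and on $\mathcal S_k$ (e.g. via line-search), but not on future samples; $\gamma_{-1}$ and $x_0$ are deterministic. DecPolyakSEG: given $x_0\in\mathbb{R}^d$, a non-decreasing positive sequence $\{c_k\}_{k\ge -1}$, and $\gamma_k$ with $0<\gamma_k\le\frac{c_{k-1}}{c_k}\gamma_{k-1}$ for $k\ge 0$, set $\alpha_{-1}=\infty$ and for $k=0,1,\dots$: sample $\mathcal S_k$ and set $$\hat x_k=x_k-\gamma_kF_{\mathcal S_k}(x_k),\quad\alpha_k=\min\left\{\frac{\langle F_{\mathcal S_k}(\hat x_k),x_k-\hat x_k\rangle}{\|F_{\mathcal S_k}(\hat x_k)\|^2},\alpha_{k-1}\right\},\quad x_{k+1}=x_k-\alpha_kF_{\mathcal S_k}(\hat x_k).$$ Convention: if $F_{\mathcal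 S_k}(\hat x_k)=0$, set $\alpha_k=\min\{\alpha_{k-1},\gamma_k\}$, so that $x_{k+1}=x_k$. *)

theory Defs
  imports "HOL-Probability.Probability"
begin

definition monotone_operator :: "('a::real_inner \<Rightarrow> 'a) \<Rightarrow> bool" where
  "monotone_operator G \<longleftrightarrow> (\<forall>x y. 0 \<le> (G x - G y) \<bullet> (x - y))"

text \<open>
  A mini-batch is a list of indices, so that repetitions (sampling with replacement) are counted
  in the average.
\<close>

definition batch_mean :: "(nat \<Rightarrow> 'a \<Rightarrow> 'a) \<Rightarrow> nat list \<Rightarrow> 'a \<Rightarrow> 'a::real_vector" where
  "batch_mean F s x = (1 / real (length s)) *\<^sub>R (\<Sum>i\<leftarrow>s. F i x)"

definition minibatch_pmf :: "nat \<Rightarrow> nat \<Rightarrow> nat list pmf" where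
  "minibatch_pmf n b = replicate_pmf b (pmf_of_set {1..n})"

text \<open>
  The \<open>\<sigma>\<close>-algebra \<open>\<F> k\<close> is the information available before iteration \<open>k\<close>. It contains at least
  what the mini-batches \<open>S 0, \<dots>, S (k - 1)\<close> generate, and it may contain further randomness
  (e.g. a randomised line-search), as long as \<open>S k\<close> is independent of it.
\<close>

locale minibatch_sampling = prob_space M + filtration "space M" \<F>
  for M :: "'w measure" and \<F> :: "nat \<Rightarrow> 'w measure" +
  fixes n b :: nat and S :: "nat \<Rightarrow> 'w \<Rightarrow> nat list"
  assumes past_subalgebra: "\<And>k. subalgebra M (\<F> k)"
    and n_pos: "1 \<le> n"
    and batch_size_pos: "1 \<le> b"
    and batch_adapted: "\<And>k. S k \<in> measurable (\<F> (Suc k)) (count_space UNIV)"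
    and batch_distr: "\<And>k. distr M (count_space UNIV) (S k) = measure_pmf (minibatch_pmf n b)"
    and batch_indep_past: "\<And>k. indep_set (sets (\<F> k))
          (sets (vimage_algebra (space M) (S k) (count_space UNIV)))"

text \<open>
  Sequences indexed from \<open>-1\<close> are represented by their value at \<open>-1\<close> and a sequence over \<^typ>\<open>nat\<close>:
  \<open>prev a f k\<close> is \<open>f\<close> at \<open>k - 1\<close>, where \<open>f\<close> at \<open>-1\<close> is \<open>a\<close>.
\<close>

definition prev :: "'b \<Rightarrow> (nat \<Rightarrow> 'b) \<Rightarrow> nat \<Rightarrow> 'b" where
  "prev a f k = (case k of 0 \<Rightarrow> a | Suc j \<Rightarrow> f j)"

text \<open>
  \<open>c_init\<close> and \<open>\<gamma>_init\<close> are \<open>c\<close> and \<open>\<gamma>\<close> at \<open>-1\<close>. Measurability of \<open>\<gamma> k\<close> with respect to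
  \<open>\<F> (Suc k)\<close> lets it depend on the past and on \<open>S k\<close>, but not on later mini-batches.
\<close>

locale dec_polyak_seg_setup = minibatch_sampling M \<F> n b S
  for M :: "'w measure" and \<F> :: "nat \<Rightarrow> 'w measure" and n b :: nat
    and S :: "nat \<Rightarrow> 'w \<Rightarrow> nat list" +
  fixes c_init :: real and c :: "nat \<Rightarrow> real"
    and \<gamma>_init :: real and \<gamma> :: "nat \<Rightarrow> 'w \<Rightarrow> real"
  assumes c_pos: "0 < c_init" "\<And>k. 0 < c k"
    and c_nondecreasing: "\<And>k. prev c_init c k \<le> c k"
    and step_adapted: "\<And>k. \<gamma> k \<in> borel_measurable (\<F> (Suc k))"
    and step_rule: "AE \<omega> in M. \<forall>k. 0 < \<gamma> k \<omega> \<and>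
          \<gamma> k \<omega> \<le> prev c_init c k / c k * prev \<gamma>_init (\<lambda>j. \<gamma> j \<omega>) k"

text \<open>
  One run of DecPolyakSEG along a fixed sample path: \<open>\<Phi> k\<close> is the sampled operator, \<open>g k\<close> the
  step-size used at iteration \<open>k\<close>. The state before iteration \<open>k\<close> is the iterate \<open>x k\<close> paired with
  \<open>\<alpha>\<close> at \<open>k - 1\<close>, which is \<open>\<infinity>\<close> for \<open>k = 0\<close>; afterwards \<open>\<alpha>\<close> is always finite.
\<close>

definition polyak_step :: "real \<Rightarrow> 'a::real_inner \<Rightarrow> 'a \<Rightarrow> 'a \<Rightarrow> ereal \<Rightarrow> ereal" where
  "polyak_step g x xh v a =
     (if v = 0 then min a (ereal g)
      else min (ereal ((v \<bullet> (x - xh)) / (norm v)\<^sup>2)) a)"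

primrec seg_state ::
  "(nat \<Rightarrow> 'a \<Rightarrow> 'a) \<Rightarrow> (nat \<Rightarrow> real) \<Rightarrow> 'a \<Rightarrow> nat \<Rightarrow> 'a::real_inner \<times> ereal" where
  "seg_state \<Phi> g x0 0 = (x0, \<infinity>)"
| "seg_state \<Phi> g x0 (Suc k) =
     (let (x, a) = seg_state \<Phi> g x0 k;
          xh = x - g k *\<^sub>R \<Phi> k x;
          v = \<Phi> k xh;
          a' = polyak_step (g k) x xh v a
      in (x - real_of_ereal a' *\<^sub>R v, a'))"

definition seg_iterate ::
  "(nat \<Rightarrow> 'a \<Rightarrow> 'a) \<Rightarrow> (nat \<Rightarrow> real) \<Rightarrow> 'a \<Rightarrow> nat \<Rightarrow> 'a::real_inner" where
  "seg_iterate \<Phi> g x0 k = fst (seg_state \<Phi> g x0 k)"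

definition seg_extrapolated ::
  "(nat \<Rightarrow> 'a \<Rightarrow> 'a) \<Rightarrow> (nat \<Rightarrow> real) \<Rightarrow> 'a \<Rightarrow> nat \<Rightarrow> 'a::real_inner" where
  "seg_extrapolated \<Phi> g x0 k =
     seg_iterate \<Phi> g x0 k - g k *\<^sub>R \<Phi> k (seg_iterate \<Phi> g x0 k)"

definition seg_alpha ::
  "(nat \<Rightarrow> 'a \<Rightarrow> 'a) \<Rightarrow> (nat \<Rightarrow> real) \<Rightarrow> 'a::real_inner \<Rightarrow> nat \<Rightarrow> real" where
  "seg_alpha \<Phi> g x0 k = real_of_ereal (snd (seg_state \<Phi> g x0 (Suc k)))"

text \<open>Sanity check: the run satisfies the defining equations of the algorithm.\<close>

lemma seg_iterate_0: "seg_iterate \<Phi> g x0 0 = x0"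
  by (simp add: seg_iterate_def)

lemma seg_state_finite: "\<exists>r. snd (seg_state \<Phi> g x0 (Suc k)) = ereal r"
proof (induction k)
  case 0
  show ?case by (auto simp: polyak_step_def Let_def min_def)
next
  case (Suc k)
  then show ?case
    by (subst seg_state.simps)
       (auto simp: polyak_step_def Let_def min_def simp del: seg_state.simps split: prod.splits)
qed

lemma seg_iterate_Suc:
  "seg_iterate \<Phi> g x0 (Suc k) = seg_iterate \<Phi> g x0 k
     - seg_alpha \<Phi> g x0 k *\<^sub>R \<Phi> k (seg_extrapolated \<Phi> g x0 k)"
  by (simp add: seg_iterate_def seg_alpha_def seg_extrapolated_def Let_def split: prod.splits)

lemma seg_alpha_eq:
  "ereal (seg_alpha \<Phi> g x0 k) =
     polyak_step (g k) (seg_iterate \<Phi> g x0 k) (seg_extrapolated \<Phi> g x0 k)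
       (\<Phi> k (seg_extrapolated \<Phi> g x0 k)) (prev \<infinity> (\<lambda>j. ereal (seg_alpha \<Phi> g x0 j)) k)"
proof -
  have prev_eq: "prev \<infinity> (\<lambda>j. ereal (seg_alpha \<Phi> g x0 j)) k = snd (seg_state \<Phi> g x0 k)"
  proof (cases k)
    case (Suc j)
    then show ?thesis
      using seg_state_finite[of \<Phi> g x0 j] by (auto simp: prev_def seg_alpha_def)
  qed (simp add: prev_def)
  have "ereal (seg_alpha \<Phi> g x0 k) = snd (seg_state \<Phi> g x0 (Suc k))"
    using seg_state_finite[of \<Phi> g x0 k] by (auto simp: seg_alpha_def simp del: seg_state.simps)
  then show ?thesis
    unfolding prev_eq
    by (simp add: seg_iterate_def seg_extrapolated_def Let_def split: prod.splits)
qed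

end

theory Submission
  imports Defs
begin

text \<open>
  Write \<open>v\<^sub>k\<close> for the sampled operator at the extrapolated point \<open>xh\<^sub>k\<close>, \<open>xbar\<close> for the average of
  the extrapolated points and \<open>D\<close> for the diameter of \<open>C\<close>.

  A Lipschitz monotone operator has a small residual wherever it has a small gap: for the comparison
  point \<open>z = xbar - F xbar / (2 L)\<close> one has
  \<open>\<parallel>F xbar\<parallel>\<^sup>2 \<le> 4 L / (K + 1) * (\<Sum>k\<le>K. F xh\<^sub>k \<bullet> (xh\<^sub>k - z))\<close> (\<open>residual_le_gap\<close>). Since
  \<open>\<parallel>F xbar\<parallel> \<le> L D\<close>, the point \<open>z\<close> is at distance at most \<open>3 D / 2\<close> from every point of \<open>C\<close>; this is
  the origin of the factors 9/8 and 3/2.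

  On every sample path the sampled gap is controlled by the Polyak step alone. Its step-size
  satisfies \<open>\<alpha>\<^sub>k \<parallel>v\<^sub>k\<parallel>\<^sup>2 \<le> v\<^sub>k \<bullet> (x\<^sub>k - xh\<^sub>k)\<close>, so the second-order term of the update is absorbed by the
  extrapolation, and because \<open>\<alpha>\<close> is positive and non-increasing the distances to \<open>z\<close> telescope:
  \<open>(\<Sum>k\<le>K. v\<^sub>k \<bullet> (xh\<^sub>k - z)) \<le> (3 D / 2)\<^sup>2 / (2 \<alpha>\<^sub>K)\<close> (\<open>seg_regret_le\<close>).

  It remains to replace \<open>v\<^sub>k\<close> by \<open>F xh\<^sub>k\<close>. Both \<open>xh\<^sub>k\<close> and \<open>z\<close> depend on the mini-batch, so the
  error is first moved to \<open>x\<^sub>k\<close>, which does not (\<open>inner_oracle_error_le\<close>). Moving costs at most the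
  step-size, bounded by \<open>\<gamma>_init / sqrt (k + 1)\<close>, times a function of \<open>x\<^sub>k\<close> and the mini-batch with
  mean at most \<open>\<sigma>\<^sup>2 + 9 L\<^sup>2 D\<^sup>2\<close> (\<open>extrapolation_cost_le\<close>). What is left is the noise
  \<open>\<xi>\<^sub>k = F x\<^sub>k - F\<^sub>S x\<^sub>k\<close> paired with \<open>x\<^sub>k - z\<close>. Paired with \<open>x\<^sub>k - xstar\<close> it has mean zero; the remaining
  \<open>(\<Sum>k\<le>K. \<xi>\<^sub>k) \<bullet> (xstar - z)\<close> is at most \<open>3 D / 2\<close> times the norm of a martingale, whose mean is at
  most \<open>\<sigma> sqrt (K + 1)\<close> by orthogonality of the increments (\<open>expectation_norm_total_noise_le\<close>).
\<close>

section \<open>The regret of a Polyak-type extragradient run\<close>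

text \<open>
  If the angle between \<open>u\<close> and a nonzero \<open>v\<close> were not acute, then \<open>v\<close> would be further from \<open>u\<close>
  than the origin is, that is, the relative error would exceed 1.
\<close>

lemma inner_pos_of_relative_error:
  fixes u v :: "'a::real_inner"
  assumes close: "norm (v - u) \<le> A * norm u" and "A < 1" and "v \<noteq> 0"
  shows "0 < v \<bullet> u"
proof (rule ccontr)
  assume "\<not> 0 < v \<bullet> u"
  then have "(norm u)\<^sup>2 < (norm (v - u))\<^sup>2"
  proof -
    have "(norm (v - u))\<^sup>2 = (norm u)\<^sup>2 + (norm v)\<^sup>2 - 2 * (v \<bullet> u)"
      by (simp add: power2_norm_eq_inner inner_diff inner_commute)
    moreover have "0 < (norm v)\<^sup>2" using \<open>v \<noteq> 0\<close> by simp
    ultimately show ?thesis using \<open>\<not> 0 < v \<bullet> u\<close> by linarith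
  qed
  moreover have "norm (v - u) \<le> norm u"
    using close mult_right_mono[of A 1 "norm u"] \<open>A < 1\<close> by simp
  ultimately show False
    by (meson norm_ge_zero not_less power_mono)
qed

text \<open>
  The Polyak ratio is positive because the critical condition makes the angle between \<open>v\<close> and \<open>u\<close>
  acute. If \<open>v = 0\<close>, positivity comes from \<open>g\<close>, and the last inequality is \<open>0 \<le> 0\<close>; otherwise that
  inequality is the ratio with its denominator cleared.
\<close>

lemma polyak_step_bounds:
  fixes u v x :: "'a::real_inner"
  assumes close: "norm (v - u) \<le> A * norm u" and "A < 1" and "0 < g"
    and step: "polyak_step g x (x - g *\<^sub>R u) v a = ereal r"
  shows polyak_step_pos: "0 < a \<Longrightarrow> 0 < r"
    and polyak_step_le: "ereal r \<le> a"
    and polyak_step_inner: "r * (norm v)\<^sup>2 \<le> v \<bullet> (x - (x - g *\<^sub>R u))"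
proof -
  have ur: "polyak_step g x (x - g *\<^sub>R u) v a =
      (if v = 0 then min a (ereal g) else min (ereal ((v \<bullet> g *\<^sub>R u) / (norm v)\<^sup>2)) a)"
    by (simp add: polyak_step_def)
  show "0 < r" if "0 < a"
  proof (cases "v = 0")
    case True
    with step ur \<open>0 < g\<close> that have "0 < ereal r" by (auto simp: min_def split: if_splits)
    then show ?thesis by simp
  next
    case False
    have "0 < (v \<bullet> g *\<^sub>R u) / (norm v)\<^sup>2"
      using inner_pos_of_relative_error[OF close \<open>A < 1\<close> False] \<open>0 < g\<close> False by simp
    with step ur False that have "0 < ereal r" by (auto simp: min_def split: if_splits)
    then show ?thesis by simp
  qed
  show "ereal r \<le> a"
    unfolding step[symmetric] ur by simp
  show "r * (norm v)\<^sup>2 \<le> v \<bullet> (x - (x - g *\<^sub>R u))"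
  proof (cases "v = 0")
    case False
    have "ereal r \<le> ereal ((v \<bullet> g *\<^sub>R u) / (norm v)\<^sup>2)"
      unfolding step[symmetric] ur using False by simp
    then show ?thesis
      using False by (simp add: field_simps)
  qed simp
qed

lemma seg_alpha_bounds:
  fixes \<Phi> :: "nat \<Rightarrow> 'a \<Rightarrow> 'a::real_inner" and g :: "nat \<Rightarrow> real" and x0 :: 'a
  defines "x \<equiv> seg_iterate \<Phi> g x0" and "xh \<equiv> seg_extrapolated \<Phi> g x0" and "\<alpha> \<equiv> seg_alpha \<Phi> g x0"
  assumes critical: "\<And>k. norm (\<Phi> k (xh k) - \<Phi> k (x k)) \<le> A * norm (\<Phi> k (x k))"
    and "A < 1" and g_pos: "\<And>k. 0 < g k"
  shows seg_alpha_pos: "0 < \<alpha> k"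
    and seg_alpha_decreasing: "\<alpha> (Suc k) \<le> \<alpha> k"
    and seg_alpha_inner: "\<alpha> k * (norm (\<Phi> k (xh k)))\<^sup>2 \<le> \<Phi> k (xh k) \<bullet> (x k - xh k)"
proof -
  have xh: "xh k = x k - g k *\<^sub>R \<Phi> k (x k)" for k
    by (simp add: xh_def x_def seg_extrapolated_def)
  have step: "polyak_step (g k) (x k) (x k - g k *\<^sub>R \<Phi> k (x k)) (\<Phi> k (xh k))
      (prev \<infinity> (\<lambda>j. ereal (\<alpha> j)) k) = ereal (\<alpha> k)" for k
  proof -
    have "polyak_step (g k) (x k) (xh k) (\<Phi> k (xh k)) (prev \<infinity> (\<lambda>j. ereal (\<alpha> j)) k) = ereal (\<alpha> k)"
      unfolding x_def xh_def \<alpha>_def by (rule seg_alpha_eq[symmetric])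
    then show ?thesis by (simp add: xh)
  qed
  note bounds = polyak_step_bounds[OF critical \<open>A < 1\<close> g_pos step]
  show "0 < \<alpha> k"
  proof (induction k)
    case 0
    show ?case by (rule bounds(1)) (simp add: prev_def)
  next
    case (Suc k)
    then show ?case by (intro bounds(1)) (simp add: prev_def)
  qed
  show "\<alpha> (Suc k) \<le> \<alpha> k"
    using bounds(2)[of "Suc k"] by (simp add: prev_def)
  show "\<alpha> k * (norm (\<Phi> k (xh k)))\<^sup>2 \<le> \<Phi> k (xh k) \<bullet> (x k - xh k)"
    using bounds(3)[of k] by (simp add: xh)
qed

text \<open>
  Summation by parts: the weights \<open>1 / a k\<close> increase, and every \<open>d k\<close> is at most \<open>B\<close>, so raising a
  weight can only raise the share of \<open>B - d k\<close>. The induction therefore carries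
  \<open>(B - d (Suc k)) / a k\<close>.
\<close>

lemma sum_decrease_div_decreasing_le:
  fixes a d :: "nat \<Rightarrow> real"
  assumes a_pos: "\<And>k. 0 < a k" and a_dec: "\<And>k. a (Suc k) \<le> a k"
    and d_nonneg: "\<And>k. 0 \<le> d k" and d_le: "\<And>k. k \<le> K \<Longrightarrow> d k \<le> B"
  shows "(\<Sum>k\<le>K. (d k - d (Suc k)) / a k) \<le> B / a K"
proof -
  have "k \<le> K \<Longrightarrow> (\<Sum>j\<le>k. (d j - d (Suc j)) / a j) \<le> (B - d (Suc k)) / a k" for k
  proof (induction k)
    case 0
    then show ?case using a_pos[of 0] d_le[of 0] by (simp add: divide_right_mono)
  next
    case (Suc k)
    have "(B - d (Suc k)) / a k \<le> (B - d (Suc k)) / a (Suc k)"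
      using a_pos a_dec d_le[OF Suc.prems] by (intro divide_left_mono) auto
    with Suc show ?case by (simp add: diff_divide_distrib)
  qed
  then have "(\<Sum>k\<le>K. (d k - d (Suc k)) / a k) \<le> (B - d (Suc K)) / a K" by simp
  also have "\<dots> \<le> B / a K"
    using a_pos[of K] d_nonneg by (intro divide_right_mono) auto
  finally show ?thesis .
qed

text \<open>
  Expanding \<open>\<parallel>x\<^sub>k\<^sub>+\<^sub>1 - z\<parallel>\<^sup>2\<close>, the quadratic term \<open>\<alpha>\<^sub>k\<^sup>2 \<parallel>v\<^sub>k\<parallel>\<^sup>2\<close> is at most
  \<open>2 \<alpha>\<^sub>k (v\<^sub>k \<bullet> (x\<^sub>k - xh\<^sub>k))\<close>, exactly what turns \<open>v\<^sub>k \<bullet> (x\<^sub>k - z)\<close> into \<open>v\<^sub>k \<bullet> (xh\<^sub>k - z)\<close>. The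
  comparison point \<open>z\<close> is arbitrary; it may depend on the whole run.
\<close>

lemma seg_regret_le:
  fixes \<Phi> :: "nat \<Rightarrow> 'a \<Rightarrow> 'a::real_inner" and g :: "nat \<Rightarrow> real" and x0 z :: 'a
  defines "x \<equiv> seg_iterate \<Phi> g x0" and "xh \<equiv> seg_extrapolated \<Phi> g x0" and "\<alpha> \<equiv> seg_alpha \<Phi> g x0"
  assumes critical: "\<And>k. norm (\<Phi> k (xh k) - \<Phi> k (x k)) \<le> A * norm (\<Phi> k (x k))"
    and "A < 1" and g_pos: "\<And>k. 0 < g k"
    and near: "\<And>k. k \<le> K \<Longrightarrow> norm (x k - z) \<le> R"
  shows "(\<Sum>k\<le>K. \<Phi> k (xh k) \<bullet> (xh k - z)) \<le> R\<^sup>2 / (2 * \<alpha> K)"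
proof -
  note \<alpha> = seg_alpha_bounds[where \<Phi>=\<Phi> and g=g and ?x0.0=x0, folded x_def xh_def \<alpha>_def,
      OF critical \<open>A < 1\<close> g_pos]
  define d where "d k = (norm (x k - z))\<^sup>2" for k
  have one_step: "\<Phi> k (xh k) \<bullet> (xh k - z) \<le> ((d k - d (Suc k)) / \<alpha> k) / 2" for k
  proof -
    let ?v = "\<Phi> k (xh k)"
    have x_Suc: "x (Suc k) - z = (x k - z) - \<alpha> k *\<^sub>R ?v"
      by (simp add: x_def xh_def \<alpha>_def seg_iterate_Suc)
    have "d (Suc k) = d k - 2 * \<alpha> k * (?v \<bullet> (x k - z)) + \<alpha> k * (\<alpha> k * (norm ?v)\<^sup>2)"
      unfolding d_def x_Suc
      by (simp add: power2_norm_eq_inner inner_diff inner_commute algebra_simps)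
    also have "\<dots> \<le> d k - 2 * \<alpha> k * (?v \<bullet> (x k - z)) + \<alpha> k * (2 * (?v \<bullet> (x k - xh k)))"
    proof -
      have "0 \<le> \<alpha> k * (norm ?v)\<^sup>2"
        using \<alpha>(1)[of k] by simp
      then have "\<alpha> k * (norm ?v)\<^sup>2 \<le> 2 * (?v \<bullet> (x k - xh k))"
        using \<alpha>(3)[of k] by linarith
      then show ?thesis
        using \<alpha>(1)[of k] by (intro add_left_mono mult_left_mono) auto
    qed
    also have "\<dots> = d k - 2 * \<alpha> k * (?v \<bullet> (xh k - z))"
      by (simp add: inner_diff algebra_simps)
    finally show ?thesis
      using \<alpha>(1)[of k] by (simp add: field_simps)
  qed
  have "(\<Sum>k\<le>K. \<Phi> k (xh k) \<bullet> (xh k - z)) \<le> (\<Sum>k\<le>K. (d k - d (Suc k)) / \<alpha> k) / 2"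
    unfolding sum_divide_distrib by (intro sum_mono one_step)
  also have "\<dots> \<le> (R\<^sup>2 / \<alpha> K) / 2"
    using near by (intro divide_right_mono sum_decrease_div_decreasing_le \<alpha>) (auto simp: d_def power_mono)
  finally show ?thesis by simp
qed

section \<open>The residual of an average\<close>

text \<open>
  Monotonicity moves \<open>F\<close> from the points \<open>y k\<close> to \<open>z\<close>, where the average of \<open>F z \<bullet> (y k - z)\<close> is
  \<open>F z \<bullet> F ybar / (2 L)\<close>. The length \<open>1 / (2 L)\<close> of the step from \<open>ybar\<close> to \<open>z\<close> keeps \<open>F z\<close> within
  \<open>\<parallel>F ybar\<parallel> / 2\<close> of \<open>F ybar\<close>, and maximises \<open>t (1 - t L)\<close> over step lengths \<open>t\<close>.
\<close>

lemma residual_le_gap: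
  fixes F :: "'a::real_inner \<Rightarrow> 'a" and y :: "nat \<Rightarrow> 'a" and K :: nat
  assumes mono: "monotone_operator F" and lip: "L-lipschitz_on UNIV F" and "0 < L"
  defines "ybar \<equiv> (1 / (real K + 1)) *\<^sub>R (\<Sum>k\<le>K. y k)"
  defines "z \<equiv> ybar - (1 / (2 * L)) *\<^sub>R F ybar"
  shows "(norm (F ybar))\<^sup>2 \<le> 4 * L * (1 / (real K + 1) * (\<Sum>k\<le>K. F (y k) \<bullet> (y k - z)))"
proof -
  let ?N = "norm (F ybar)"
  have sum_y: "(\<Sum>k\<le>K. y k - z) = (real K + 1) *\<^sub>R (ybar - z)"
    unfolding sum_subtractf ybar_def scaleR_diff_right
    by (simp add: add.commute sum_constant_scaleR del: sum_constant)
  have diff: "norm (F z - F ybar) \<le> ?N / 2"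
  proof -
    have "norm (F z - F ybar) \<le> L * norm (z - ybar)"
      using lipschitz_onD[OF lip, of z ybar] by (simp add: dist_norm)
    also have "\<dots> = ?N / 2"
      using \<open>0 < L\<close> by (simp add: z_def)
    finally show ?thesis .
  qed
  have "?N\<^sup>2 / 2 \<le> F z \<bullet> F ybar"
  proof -
    have "\<bar>(F z - F ybar) \<bullet> F ybar\<bar> \<le> norm (F z - F ybar) * ?N"
      by (rule Cauchy_Schwarz_ineq2)
    also have "\<dots> \<le> ?N / 2 * ?N"
      using diff by (intro mult_right_mono) auto
    finally have "\<bar>(F z - F ybar) \<bullet> F ybar\<bar> \<le> ?N\<^sup>2 / 2"
      by (simp add: power2_eq_square)
    moreover have "(F z - F ybar) \<bullet> F ybar = F z \<bullet> F ybar - ?N\<^sup>2"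
      by (simp add: inner_diff_left power2_norm_eq_inner)
    ultimately show ?thesis by linarith
  qed
  then have "?N\<^sup>2 / (4 * L) \<le> F z \<bullet> (ybar - z)"
    using \<open>0 < L\<close> by (simp add: z_def field_simps)
  also have "\<dots> = 1 / (real K + 1) * (F z \<bullet> (\<Sum>k\<le>K. y k - z))"
    unfolding sum_y by simp
  also have "\<dots> = 1 / (real K + 1) * (\<Sum>k\<le>K. F z \<bullet> (y k - z))"
    by (simp only: inner_sum_right)
  also have "\<dots> \<le> 1 / (real K + 1) * (\<Sum>k\<le>K. F (y k) \<bullet> (y k - z))"
    using mono by (intro mult_left_mono sum_mono) (auto simp: monotone_operator_def inner_diff_left)
  finally show ?thesis
    using \<open>0 < L\<close> by (simp add: field_simps)
qed

section \<open>The oracle error at the extrapolated point\<close>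

lemma inner_diff_half_le:
  fixes m u :: "'a::real_inner"
  shows "(u - m) \<bullet> u \<le> (norm (u - (1/2) *\<^sub>R m))\<^sup>2"
proof -
  have "(norm (u - (1/2) *\<^sub>R m))\<^sup>2 = (u - m) \<bullet> u + (m \<bullet> m) / 4"
    by (simp add: power2_norm_eq_inner inner_diff inner_commute)
  then show ?thesis by simp
qed

text \<open>
  The error \<open>F - G\<close> of the oracle is evaluated at a point that itself depends on \<open>G\<close>. Its variation
  from \<open>x\<close> to \<open>xh\<close> is of order \<open>g\<close> by the Lipschitz bounds, and so is the displacement of the test
  vector \<open>xh - z\<close> from \<open>x - z\<close>, which contributes \<open>g ((G x - F x) \<bullet> G x)\<close>. That product may be
  negative; it is replaced by a square so that \<open>g\<close>, which may depend on the sample, can be replaced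
  by a deterministic bound \<open>h\<close>.
\<close>

lemma inner_oracle_error_le:
  fixes F G :: "'a::real_inner \<Rightarrow> 'a"
  assumes F: "L-lipschitz_on UNIV F" and G: "L-lipschitz_on UNIV G"
    and near: "norm (x - g *\<^sub>R G x - z) \<le> R" and g: "0 \<le> g" "g \<le> h"
  defines "xh \<equiv> x - g *\<^sub>R G x"
  shows "F xh \<bullet> (xh - z) \<le> G xh \<bullet> (xh - z) + (F x - G x) \<bullet> (x - z)
    + h * (2 * L * R * norm (G x) + (norm (G x - (1/2) *\<^sub>R F x))\<^sup>2)"
proof -
  define \<Delta> where "\<Delta> = (F xh - F x) - (G xh - G x)"
  have L: "0 \<le> L" using F by (rule lipschitz_on_nonneg)
  have R: "0 \<le> R" using near norm_ge_zero order_trans by blast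
  have move: "norm (xh - x) = g * norm (G x)"
    using g by (simp add: xh_def)
  have "norm \<Delta> \<le> norm (F xh - F x) + norm (G xh - G x)"
    unfolding \<Delta>_def by (rule norm_triangle_ineq4)
  also have "\<dots> \<le> L * norm (xh - x) + L * norm (xh - x)"
    using lipschitz_onD[OF F, of xh x] lipschitz_onD[OF G, of xh x] by (intro add_mono) (auto simp: dist_norm)
  finally have "norm \<Delta> \<le> 2 * L * (g * norm (G x))"
    by (simp add: move)
  then have "norm \<Delta> * norm (xh - z) \<le> (2 * L * (g * norm (G x))) * R"
    using near L g by (intro mult_mono) (auto simp: xh_def)
  then have drift: "\<Delta> \<bullet> (xh - z) \<le> g * (2 * L * R * norm (G x))"
    using norm_cauchy_schwarz[of \<Delta> "xh - z"] by (simp add: mult_ac)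
  have "g * ((G x - F x) \<bullet> G x) \<le> g * (norm (G x - (1/2) *\<^sub>R F x))\<^sup>2"
    using g inner_diff_half_le by (intro mult_left_mono) auto
  moreover have "F xh \<bullet> (xh - z) = G xh \<bullet> (xh - z) + (F x - G x) \<bullet> (x - z)
      + g * ((G x - F x) \<bullet> G x) + \<Delta> \<bullet> (xh - z)"
    by (simp add: \<Delta>_def xh_def inner_diff_left inner_diff_right algebra_simps)
  moreover have "g * (2 * L * R * norm (G x) + (norm (G x - (1/2) *\<^sub>R F x))\<^sup>2)
      \<le> h * (2 * L * R * norm (G x) + (norm (G x - (1/2) *\<^sub>R F x))\<^sup>2)"
    using g L R by (intro mult_right_mono) auto
  ultimately show ?thesis
    using drift by (simp add: distrib_left)
qed

section \<open>Moments of a mini-batch estimate\<close>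

lemma finite_set_minibatch_pmf: "1 \<le> n \<Longrightarrow> finite (set_pmf (minibatch_pmf n b))"
  unfolding minibatch_pmf_def set_replicate_pmf
  using finite_lists_length_eq[of "{1..n}" b] by (simp add: lists_eq_set)

lemma set_minibatch_pmfD:
  assumes "1 \<le> n" "s \<in> set_pmf (minibatch_pmf n b)"
  shows "set s \<subseteq> {1..n}"
  using assms by (auto simp: minibatch_pmf_def set_replicate_pmf set_pmf_of_set)

text \<open>
  Linearity over the head and the tail of the list, whose marginals are \<open>p\<close> and the shorter
  replication.
\<close>

lemma expectation_sum_list_replicate_pmf:
  fixes f :: "'i \<Rightarrow> 'b::{banach, second_countable_topology}"
  assumes "finite (set_pmf p)"
  shows "measure_pmf.expectation (replicate_pmf b p) (\<lambda>s. \<Sum>i\<leftarrow>s. f i)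
      = real b *\<^sub>R measure_pmf.expectation p f"
proof (induction b)
  case (Suc b)
  let ?q = "pair_pmf p (replicate_pmf b p)"
  have fin: "finite (set_pmf ?q)"
    using assms finite_lists_length_eq[of "set_pmf p" b] by (simp add: set_replicate_pmf lists_eq_set)
  have "replicate_pmf (Suc b) p = map_pmf (\<lambda>y. fst y # snd y) ?q"
    by (simp add: pair_pmf_def map_bind_pmf bind_assoc_pmf map_pmf_def bind_return_pmf)
  then have "measure_pmf.expectation (replicate_pmf (Suc b) p) (\<lambda>s. \<Sum>i\<leftarrow>s. f i)
      = measure_pmf.expectation ?q (\<lambda>y. f (fst y) + (\<Sum>i\<leftarrow>snd y. f i))"
    by simp
  also have "\<dots> = measure_pmf.expectation ?q (\<lambda>y. f (fst y))
      + measure_pmf.expectation ?q (\<lambda>y. \<Sum>i\<leftarrow>snd y. f i)"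
    by (intro Bochner_Integration.integral_add integrable_measure_pmf_finite fin)
  also have "\<dots> = measure_pmf.expectation (map_pmf fst ?q) f
      + measure_pmf.expectation (map_pmf snd ?q) (\<lambda>s. \<Sum>i\<leftarrow>s. f i)"
    by simp
  also have "\<dots> = real (Suc b) *\<^sub>R measure_pmf.expectation p f"
    unfolding map_fst_pair_pmf map_snd_pair_pmf Suc by (simp add: scaleR_left_distrib)
  finally show ?case .
qed simp

lemma batch_mean_unbiased:
  fixes Fi :: "nat \<Rightarrow> 'a \<Rightarrow> 'a::euclidean_space"
  assumes "1 \<le> n" "1 \<le> b"
  shows "measure_pmf.expectation (minibatch_pmf n b) (\<lambda>s. batch_mean Fi s z)
      = (1 / real n) *\<^sub>R (\<Sum>i=1..n. Fi i z)"
proof -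
  let ?U = "pmf_of_set {1..n}"
  have "measure_pmf.expectation (minibatch_pmf n b) (\<lambda>s. batch_mean Fi s z)
      = measure_pmf.expectation (minibatch_pmf n b) (\<lambda>s. (1 / real b) *\<^sub>R (\<Sum>i\<leftarrow>s. Fi i z))"
    by (intro integral_cong_AE)
       (auto simp: AE_measure_pmf_iff batch_mean_def minibatch_pmf_def set_replicate_pmf)
  also have "\<dots> = (1 / real b) *\<^sub>R (real b *\<^sub>R measure_pmf.expectation ?U (\<lambda>i. Fi i z))"
    using assms by (simp add: minibatch_pmf_def expectation_sum_list_replicate_pmf set_pmf_of_set)
  also have "measure_pmf.expectation ?U (\<lambda>i. Fi i z) = (\<Sum>i=1..n. (1 / real n) *\<^sub>R Fi i z)"
    using assms by (subst integral_measure_pmf[of "{1..n}"]) auto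
  finally show ?thesis
    using assms by (simp add: scaleR_sum_right)
qed

lemma norm_batch_mean_diff_le:
  fixes Fi :: "nat \<Rightarrow> 'a \<Rightarrow> 'a::real_normed_vector"
  assumes "\<And>i. i \<in> set s \<Longrightarrow> norm (Fi i y - Fi i z) \<le> B" and "0 \<le> B"
  shows "norm (batch_mean Fi s y - batch_mean Fi s z) \<le> B"
proof -
  have "norm ((\<Sum>i\<leftarrow>s. Fi i y) - (\<Sum>i\<leftarrow>s. Fi i z)) \<le> real (length s) * B"
    using assms(1)
  proof (induction s)
    case (Cons i s)
    have "norm ((Fi i y - Fi i z) + ((\<Sum>i\<leftarrow>s. Fi i y) - (\<Sum>i\<leftarrow>s. Fi i z))) \<le> B + real (length s) * B"
      using Cons by (intro norm_triangle_mono) auto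
    then show ?case by (simp add: algebra_simps)
  qed simp
  moreover have "batch_mean Fi s y - batch_mean Fi s z
      = (1 / real (length s)) *\<^sub>R ((\<Sum>i\<leftarrow>s. Fi i y) - (\<Sum>i\<leftarrow>s. Fi i z))"
    by (simp add: batch_mean_def scaleR_diff_right)
  ultimately show ?thesis
    using \<open>0 \<le> B\<close> by (cases "s = []") (simp_all add: divide_le_eq mult.commute)
qed

lemma lipschitz_batch_mean:
  fixes Fi :: "nat \<Rightarrow> 'a \<Rightarrow> 'a::real_normed_vector"
  assumes "\<And>i. i \<in> set s \<Longrightarrow> L-lipschitz_on UNIV (Fi i)" and "0 \<le> L"
  shows "L-lipschitz_on UNIV (batch_mean Fi s)"
proof (rule lipschitz_onI)
  fix y z
  show "dist (batch_mean Fi s y) (batch_mean Fi s z) \<le> L * dist y z"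
    unfolding dist_norm
  proof (rule norm_batch_mean_diff_le)
    show "norm (Fi i y - Fi i z) \<le> L * norm (y - z)" if "i \<in> set s" for i
      using lipschitz_onD[OF assms(1)[OF that], of y z] by (simp add: dist_norm)
  qed (use \<open>0 \<le> L\<close> in simp)
qed fact

lemma second_moment_shifted:
  fixes u :: "'i \<Rightarrow> 'a::euclidean_space"
  assumes fin: "finite (set_pmf p)" and mean: "measure_pmf.expectation p u = m"
  shows "measure_pmf.expectation p (\<lambda>s. (norm (u s - t *\<^sub>R m))\<^sup>2)
      = measure_pmf.expectation p (\<lambda>s. (norm (u s))\<^sup>2) - t * (2 - t) * (norm m)\<^sup>2"
proof -
  note [simp] = integrable_measure_pmf_finite[OF fin]
  have "(norm (u s - t *\<^sub>R m))\<^sup>2 = ((norm (u s))\<^sup>2 + t\<^sup>2 * (norm m)\<^sup>2) - 2 * t * (u s \<bullet> m)" for s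
    unfolding power2_norm_eq_inner
    by (simp add: inner_diff inner_commute power2_eq_square algebra_simps)
  then have "measure_pmf.expectation p (\<lambda>s. (norm (u s - t *\<^sub>R m))\<^sup>2)
      = measure_pmf.expectation p (\<lambda>s. ((norm (u s))\<^sup>2 + t\<^sup>2 * (norm m)\<^sup>2) - 2 * t * (u s \<bullet> m))"
    by simp
  also have "\<dots> = measure_pmf.expectation p (\<lambda>s. (norm (u s))\<^sup>2) + t\<^sup>2 * (norm m)\<^sup>2
      - 2 * t * measure_pmf.expectation p (\<lambda>s. u s \<bullet> m)"
    by simp
  also have "measure_pmf.expectation p (\<lambda>s. u s \<bullet> m) = (norm m)\<^sup>2"
    by (simp add: mean power2_norm_eq_inner)
  finally show ?thesis
    by (simp add: algebra_simps power2_eq_square)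
qed

text \<open>
  Shifting an estimate by its mean or by half of it does not raise the second moment. The constants
  of the second bound are those for which
  \<open>11 l\<^sup>2 + 2 r\<^sup>2 - 3 l (l + r) - (l + r)\<^sup>2 = 7 l\<^sup>2 - 5 l r + r\<^sup>2\<close> is a positive semidefinite form.
\<close>

lemma estimate_moment_bounds:
  fixes u :: "'i \<Rightarrow> 'a::euclidean_space" and r :: "'i \<Rightarrow> real"
  assumes fin: "finite (set_pmf p)" and mean: "measure_pmf.expectation p u = m"
    and bound: "\<And>s. s \<in> set_pmf p \<Longrightarrow> norm (u s) \<le> l + r s"
    and l: "0 \<le> l" and r: "\<And>s. 0 \<le> r s"
  defines "V \<equiv> 2 * l\<^sup>2 + 2 * measure_pmf.expectation p (\<lambda>s. (r s)\<^sup>2)"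
  shows estimate_variance_le: "measure_pmf.expectation p (\<lambda>s. (norm (m - u s))\<^sup>2) \<le> V"
    and estimate_extrapolation_cost_le: "measure_pmf.expectation p
        (\<lambda>s. 3 * l * norm (u s) + (norm (u s - (1/2) *\<^sub>R m))\<^sup>2) \<le> V + 9 * l\<^sup>2"
proof -
  note [simp] = integrable_measure_pmf_finite[OF fin]
  have sq: "(norm (u s))\<^sup>2 \<le> (l + r s)\<^sup>2" if "s \<in> set_pmf p" for s
    using bound[OF that] by (simp add: power_mono)
  have "measure_pmf.expectation p (\<lambda>s. (norm (m - u s))\<^sup>2)
      \<le> measure_pmf.expectation p (\<lambda>s. (norm (u s))\<^sup>2)"
    using second_moment_shifted[OF fin mean, of 1] by (simp add: norm_minus_commute)
  also have "\<dots> \<le> measure_pmf.expectation p (\<lambda>s. 2 * l\<^sup>2 + 2 * (r s)\<^sup>2)"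
  proof (intro integral_mono_AE, goal_cases)
    case 3
    have "(norm (u s))\<^sup>2 \<le> 2 * l\<^sup>2 + 2 * (r s)\<^sup>2" if "s \<in> set_pmf p" for s
      using sq[OF that] zero_le_power2[of "l - r s"] unfolding power2_diff power2_sum by linarith
    then show ?case
      by (simp add: AE_measure_pmf_iff)
  qed simp_all
  finally show "measure_pmf.expectation p (\<lambda>s. (norm (m - u s))\<^sup>2) \<le> V"
    by (simp add: V_def)
  have "measure_pmf.expectation p (\<lambda>s. 3 * l * norm (u s) + (norm (u s - (1/2) *\<^sub>R m))\<^sup>2)
      \<le> measure_pmf.expectation p (\<lambda>s. 3 * l * norm (u s) + (norm (u s))\<^sup>2)"
    using second_moment_shifted[OF fin mean, of "1/2"] by simp
  also have "\<dots> \<le> measure_pmf.expectation p (\<lambda>s. 11 * l\<^sup>2 + 2 * (r s)\<^sup>2)"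
  proof (intro integral_mono_AE, goal_cases)
    case 3
    have "3 * l * norm (u s) + (norm (u s))\<^sup>2 \<le> 11 * l\<^sup>2 + 2 * (r s)\<^sup>2" if s: "s \<in> set_pmf p" for s
    proof -
      have "3 * l * norm (u s) + (norm (u s))\<^sup>2 \<le> 3 * l * (l + r s) + (l + r s)\<^sup>2"
        using bound[OF s] sq[OF s] l by (intro add_mono mult_left_mono) auto
      also have "\<dots> = 11 * l\<^sup>2 + 2 * (r s)\<^sup>2 - ((r s - 5/2 * l)\<^sup>2 + 3/4 * l\<^sup>2)"
        by (simp add: power2_eq_square algebra_simps)
      finally show ?thesis using zero_le_power2[of "r s - 5/2 * l"] zero_le_power2[of l] by linarith
    qed
    then show ?case by (simp add: AE_measure_pmf_iff)
  qed simp_all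
  finally show "measure_pmf.expectation p
        (\<lambda>s. 3 * l * norm (u s) + (norm (u s - (1/2) *\<^sub>R m))\<^sup>2) \<le> V + 9 * l\<^sup>2"
    by (simp add: V_def)
qed

section \<open>Freshness of the mini-batch\<close>

context minibatch_sampling
begin

lemma measurable_past: "f \<in> measurable (\<F> k) N \<Longrightarrow> f \<in> measurable M N"
  using past_subalgebra by (rule measurable_from_subalg)

lemma measurable_later: "f \<in> measurable (\<F> j) N \<Longrightarrow> j \<le> k \<Longrightarrow> f \<in> measurable (\<F> k) N"
  by (rule measurable_from_subalg) (auto simp: subalgebra_def space_F sets_F_mono)

lemma batch_measurable [measurable]: "S k \<in> measurable M (count_space UNIV)"
  using batch_adapted by (rule measurable_past)

lemma AE_batch_in_support: "AE \<omega> in M. \<forall>k. S k \<omega> \<in> set_pmf (minibatch_pmf n b)"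
proof -
  have "AE \<omega> in M. S k \<omega> \<in> set_pmf (minibatch_pmf n b)" for k
  proof -
    have "AE s in distr M (count_space UNIV) (S k). s \<in> set_pmf (minibatch_pmf n b)"
      unfolding batch_distr by (rule AE_pmfI)
    then show ?thesis
      by (subst (asm) AE_distr_iff) auto
  qed
  then show ?thesis by (simp add: AE_all_countable)
qed

text \<open>
  The law of the pair is a product measure, so the past can be held fixed while averaging over the
  new mini-batch. This plays the part of a conditional expectation given \<open>\<F> k\<close>.
\<close>

lemma expectation_fresh_batch:
  fixes f :: "'c \<Rightarrow> nat list \<Rightarrow> real"
  assumes W: "W \<in> measurable (\<F> k) N"
    and f: "\<And>s. (\<lambda>w. f w s) \<in> borel_measurable N"
    and int: "integrable M (\<lambda>\<omega>. f (W \<omega>) (S k \<omega>))"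
  shows "expectation (\<lambda>\<omega>. f (W \<omega>) (S k \<omega>))
    = expectation (\<lambda>\<omega>. measure_pmf.expectation (minibatch_pmf n b) (f (W \<omega>)))"
proof -
  let ?p = "minibatch_pmf n b" and ?U = "count_space UNIV :: nat list measure"
  have W' [measurable]: "W \<in> measurable M N"
    using W by (rule measurable_past)
  have f' [measurable]: "case_prod f \<in> borel_measurable (N \<Otimes>\<^sub>M ?U)"
    unfolding split_beta'
    by (rule measurable_compose_countable[where f="\<lambda>s w. f (fst w) s" and g=snd])
       (auto intro: measurable_compose[OF measurable_fst f])
  interpret PW: prob_space "distr M N W"
    by (rule prob_space_distr) measurable
  interpret P: pair_prob_space "distr M N W" "measure_pmf ?p" ..
  have joint: "distr M N W \<Otimes>\<^sub>M measure_pmf ?p = distr M (N \<Otimes>\<^sub>M ?U) (\<lambda>\<omega>. (W \<omega>, S k \<omega>))"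
  proof (rule pair_measure_eqI)
    fix A B assume A: "A \<in> sets (distr M N W)" and B: "B \<in> sets (measure_pmf ?p)"
    let ?A = "W -` A \<inter> space M" and ?B = "S k -` B \<inter> space M"
    have "?A \<in> sets (\<F> k)"
      using measurable_sets[OF W, of A] A by (simp add: space_F)
    moreover have "?B \<in> sets (vimage_algebra (space M) (S k) ?U)"
      by (auto intro: in_vimage_algebra)
    ultimately have "prob (?A \<inter> ?B) = prob ?A * prob ?B"
      by (rule indep_setD[OF batch_indep_past])
    moreover have "?A \<inter> ?B = (\<lambda>\<omega>. (W \<omega>, S k \<omega>)) -` (A \<times> B) \<inter> space M"
      by auto
    ultimately show "emeasure (distr M N W) A * emeasure (measure_pmf ?p) B
        = emeasure (distr M (N \<Otimes>\<^sub>M ?U) (\<lambda>\<omega>. (W \<omega>, S k \<omega>))) (A \<times> B)"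
      using A unfolding batch_distr[of k, symmetric]
      by (simp add: emeasure_distr emeasure_eq_measure ennreal_mult)
  qed (auto intro: PW.sigma_finite_measure_axioms measure_pmf.sigma_finite_measure_axioms intro!: sets_pair_measure_cong)
  have "integrable (distr M (N \<Otimes>\<^sub>M ?U) (\<lambda>\<omega>. (W \<omega>, S k \<omega>))) (case_prod f)"
    using int by (subst integrable_distr_eq) auto
  then have "integrable (distr M N W \<Otimes>\<^sub>M measure_pmf ?p) (case_prod f)"
    by (simp add: joint)
  then have "(\<integral>w. measure_pmf.expectation ?p (\<lambda>s. case_prod f (w, s)) \<partial>distr M N W)
      = integral\<^sup>L (distr M N W \<Otimes>\<^sub>M measure_pmf ?p) (case_prod f)"
    by (rule P.integral_fst')
  also have "\<dots> = expectation (\<lambda>\<omega>. f (W \<omega>) (S k \<omega>))"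
    unfolding joint by (subst integral_distr) auto
  also have "(\<integral>w. measure_pmf.expectation ?p (\<lambda>s. case_prod f (w, s)) \<partial>distr M N W)
      = expectation (\<lambda>\<omega>. measure_pmf.expectation ?p (f (W \<omega>)))"
  proof (subst integral_distr)
    show "(\<lambda>w. measure_pmf.expectation ?p (\<lambda>s. case_prod f (w, s))) \<in> borel_measurable N"
      using finite_set_minibatch_pmf[OF n_pos] f
      by (subst integral_measure_pmf[of "set_pmf ?p"]) auto
  qed auto
  finally show ?thesis ..
qed

end

context dec_polyak_seg_setup
begin

text \<open>
  The induction needs the iterate and the step-size together, since each is computed from both.
\<close>

lemma seg_state_adapted:
  fixes Fi :: "nat \<Rightarrow> 'a \<Rightarrow> 'a::euclidean_space"
  assumes Fi: "\<And>i. Fi i \<in> borel_measurable borel"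
  defines "\<Phi> \<equiv> \<lambda>\<omega> j. batch_mean Fi (S j \<omega>)"
  shows "(\<lambda>\<omega>. fst (seg_state (\<Phi> \<omega>) (\<lambda>j. \<gamma> j \<omega>) x0 k)) \<in> borel_measurable (\<F> k) \<and>
    (\<lambda>\<omega>. snd (seg_state (\<Phi> \<omega>) (\<lambda>j. \<gamma> j \<omega>) x0 k)) \<in> borel_measurable (\<F> k)"
proof (induction k)
  case (Suc k)
  let ?N = "\<F> (Suc k)"
  let ?x = "\<lambda>\<omega>. fst (seg_state (\<Phi> \<omega>) (\<lambda>j. \<gamma> j \<omega>) x0 k)"
  let ?a = "\<lambda>\<omega>. snd (seg_state (\<Phi> \<omega>) (\<lambda>j. \<gamma> j \<omega>) x0 k)"
  have [measurable]: "?x \<in> borel_measurable ?N" "?a \<in> borel_measurable ?N"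
    using Suc by (auto intro: measurable_later[where j=k])
  have \<Phi>: "(\<lambda>\<omega>. \<Phi> \<omega> k (y \<omega>)) \<in> borel_measurable ?N" if [measurable]: "y \<in> borel_measurable ?N" for y
    unfolding \<Phi>_def
  proof (rule measurable_compose_countable[OF _ batch_adapted])
    have [measurable]: "(\<lambda>\<omega>. \<Sum>i\<leftarrow>s. Fi i (y \<omega>)) \<in> borel_measurable ?N" for s
      by (induction s) (auto intro: borel_measurable_add measurable_compose[OF that Fi])
    show "(\<lambda>\<omega>. batch_mean Fi s (y \<omega>)) \<in> borel_measurable ?N" for s
      unfolding batch_mean_def by measurable
  qed
  note [measurable] = step_adapted[of k] \<Phi>[of ?x]
  define xh where "xh \<omega> = ?x \<omega> - \<gamma> k \<omega> *\<^sub>R \<Phi> \<omega> k (?x \<omega>)" for \<omega>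
  have xh [measurable]: "xh \<in> borel_measurable ?N"
    unfolding xh_def by measurable
  define v where "v \<omega> = \<Phi> \<omega> k (xh \<omega>)" for \<omega>
  have [measurable]: "v \<in> borel_measurable ?N"
    unfolding v_def using \<Phi>[OF xh] .
  define a where "a \<omega> = polyak_step (\<gamma> k \<omega>) (?x \<omega>) (xh \<omega>) (v \<omega>) (?a \<omega>)" for \<omega>
  have [measurable]: "a \<in> borel_measurable ?N"
    unfolding a_def polyak_step_def by measurable
  have state: "seg_state (\<Phi> \<omega>) (\<lambda>j. \<gamma> j \<omega>) x0 (Suc k) = (?x \<omega> - real_of_ereal (a \<omega>) *\<^sub>R v \<omega>, a \<omega>)" for \<omega>
    by (simp add: a_def v_def xh_def Let_def split: prod.splits)
  show ?case
    unfolding state by simp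
qed simp

lemma seg_iterate_adapted:
  fixes Fi :: "nat \<Rightarrow> 'a \<Rightarrow> 'a::euclidean_space"
  assumes "\<And>i. Fi i \<in> borel_measurable borel"
  shows "(\<lambda>\<omega>. seg_iterate (\<lambda>j. batch_mean Fi (S j \<omega>)) (\<lambda>j. \<gamma> j \<omega>) x0 k) \<in> borel_measurable (\<F> k)"
  using seg_state_adapted[of Fi x0 k, OF assms] unfolding seg_iterate_def by blast

lemma seg_alpha_measurable:
  fixes Fi :: "nat \<Rightarrow> 'a \<Rightarrow> 'a::euclidean_space"
  assumes "\<And>i. Fi i \<in> borel_measurable borel"
  shows "(\<lambda>\<omega>. seg_alpha (\<lambda>j. batch_mean Fi (S j \<omega>)) (\<lambda>j. \<gamma> j \<omega>) x0 k) \<in> borel_measurable M"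
proof -
  have "(\<lambda>\<omega>. snd (seg_state (\<lambda>j. batch_mean Fi (S j \<omega>)) (\<lambda>j. \<gamma> j \<omega>) x0 (Suc k))) \<in> borel_measurable M"
    using seg_state_adapted[of Fi x0 "Suc k", OF assms] measurable_past by blast
  then show ?thesis
    unfolding seg_alpha_def by measurable
qed

text \<open>
  The step rule says that \<open>\<gamma>\<^sub>k c\<^sub>k\<close> is non-increasing in \<open>k\<close>, starting from index -1.
\<close>

lemma step_size_le:
  "AE \<omega> in M. \<forall>k. 0 < \<gamma> k \<omega> \<and> \<gamma> k \<omega> \<le> c_init * \<gamma>_init / c k"
  using step_rule
proof eventually_elim
  case (elim \<omega>)
  have "\<gamma> k \<omega> * c k \<le> c_init * \<gamma>_init" for k
  proof (induction k)
    case 0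
    show ?case
      using elim[rule_format, of 0] c_pos(2)[of 0] by (simp add: prev_def field_simps)
  next
    case (Suc k)
    have "\<gamma> (Suc k) \<omega> * c (Suc k) \<le> \<gamma> k \<omega> * c k"
      using elim[rule_format, of "Suc k"] c_pos(2)[of "Suc k"] by (simp add: prev_def field_simps)
    with Suc show ?case by simp
  qed
  then show ?case
    using elim c_pos(2) by (simp add: pos_le_divide_eq)
qed

end

section \<open>Noise along a confined run\<close>

text \<open>
  Here every \<open>Fi i\<close> is Lipschitz, also for indices outside \<open>{1..n}\<close>. Mini-batches with such indices
  occur with probability zero, but the measurability of the run concerns them as well.
\<close>

locale confined_seg_run = dec_polyak_seg_setup M \<F> n b S 1 c \<gamma>_init \<gamma>
  for M :: "'w measure" and \<F> :: "nat \<Rightarrow> 'w measure" and n b :: nat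
    and S :: "nat \<Rightarrow> 'w \<Rightarrow> nat list" and c :: "nat \<Rightarrow> real"
    and \<gamma>_init :: real and \<gamma> :: "nat \<Rightarrow> 'w \<Rightarrow> real" +
  fixes Fi :: "nat \<Rightarrow> 'a \<Rightarrow> 'a::euclidean_space" and F :: "'a \<Rightarrow> 'a"
    and L A :: real and C :: "'a set" and xstar x0 :: 'a and x xh :: "nat \<Rightarrow> 'w \<Rightarrow> 'a"
    and \<alpha> :: "nat \<Rightarrow> 'w \<Rightarrow> real"
  assumes F_eq: "F z = (1 / real n) *\<^sub>R (\<Sum>i=1..n. Fi i z)"
    and x_eq: "x k \<omega> = seg_iterate (\<lambda>j. batch_mean Fi (S j \<omega>)) (\<lambda>j. \<gamma> j \<omega>) x0 k"
    and xh_eq: "xh k \<omega> = seg_extrapolated (\<lambda>j. batch_mean Fi (S j \<omega>)) (\<lambda>j. \<gamma> j \<omega>) x0 k"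
    and alpha_eq: "\<alpha> k \<omega> = seg_alpha (\<lambda>j. batch_mean Fi (S j \<omega>)) (\<lambda>j. \<gamma> j \<omega>) x0 k"
    and L_pos: "0 < L"
    and Fi_lipschitz: "L-lipschitz_on UNIV (Fi i)"
    and F_monotone: "monotone_operator F"
    and A_less_1: "A < 1"
    and critical: "AE \<omega> in M. \<forall>k.
          norm (batch_mean Fi (S k \<omega>) (xh k \<omega>) - batch_mean Fi (S k \<omega>) (x k \<omega>))
            \<le> A * norm (batch_mean Fi (S k \<omega>) (x k \<omega>))"
    and C_compact: "compact C" and C_convex: "convex C"
    and zero: "xstar \<in> C" "F xstar = 0"
    and run_in_C: "AE \<omega> in M. \<forall>k. x k \<omega> \<in> C \<and> xh k \<omega> \<in> C"
begin

abbreviation "batch \<equiv> minibatch_pmf n b"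

definition noise :: "'a \<Rightarrow> nat list \<Rightarrow> 'a" where
  "noise z s = F z - batch_mean Fi s z"

text \<open>
  The factor of the step-size in \<open>inner_oracle_error_le\<close> for
  \<open>R = 3 / 2 * diameter C\<close>.
\<close>

definition extrapolation_cost :: "'a \<Rightarrow> nat list \<Rightarrow> real" where
  "extrapolation_cost z s = 3 * (L * diameter C) * norm (batch_mean Fi s z)
     + (norm (batch_mean Fi s z - (1/2) *\<^sub>R F z))\<^sup>2"

definition variance_bound :: real where
  "variance_bound = 2 * (L * diameter C)\<^sup>2
     + 2 * measure_pmf.expectation batch (\<lambda>s. (norm (batch_mean Fi s xstar))\<^sup>2)"

lemma finite_batch: "finite (set_pmf batch)"
  using n_pos by (rule finite_set_minibatch_pmf)

lemma dist_C: "y \<in> C \<Longrightarrow> z \<in> C \<Longrightarrow> norm (y - z) \<le> diameter C"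
  using diameter_bounded_bound[OF compact_imp_bounded[OF C_compact], of y z] by (simp add: dist_norm)

lemma diameter_C_nonneg: "0 \<le> diameter C"
  using dist_C[OF zero(1) zero(1)] by simp

lemma lipschitz_batch: "L-lipschitz_on UNIV (batch_mean Fi s)"
  using Fi_lipschitz L_pos by (intro lipschitz_batch_mean) auto

lemma batch_unbiased: "measure_pmf.expectation batch (\<lambda>s. batch_mean Fi s z) = F z"
  using n_pos batch_size_pos by (simp add: batch_mean_unbiased F_eq)

text \<open>
  \<open>F\<close> is itself a batch mean, of the batch that contains every index once.
\<close>

lemma lipschitz_F: "L-lipschitz_on UNIV F"
proof -
  have "F = batch_mean Fi [1..<Suc n]"
    by (rule ext) (simp add: batch_mean_def F_eq sum_list_distinct_conv_sum_set atLeastLessThanSuc_atLeastAtMost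
        del: upt_Suc)
  then show ?thesis using lipschitz_batch by simp
qed

lemma continuous_batch [continuous_intros]: "continuous_on UNIV (batch_mean Fi s)"
  using lipschitz_batch by (rule lipschitz_on_continuous_on)

lemma continuous_F [continuous_intros]: "continuous_on UNIV F"
  using lipschitz_F by (rule lipschitz_on_continuous_on)

lemma continuous_noise: "continuous_on UNIV (\<lambda>z. noise z s)"
  unfolding noise_def by (intro continuous_intros)

lemma continuous_extrapolation_cost: "continuous_on UNIV (\<lambda>z. extrapolation_cost z s)"
  unfolding extrapolation_cost_def by (intro continuous_intros)

text \<open>
  The mini-batch estimate at a point of \<open>C\<close> differs from the one at \<open>xstar\<close> by at most
  \<open>L * diameter C\<close>.
\<close>

lemma moment_bounds:
  assumes "z \<in> C"
  shows noise_variance_le: "measure_pmf.expectation batch (\<lambda>s. (norm (noise z s))\<^sup>2) \<le> variance_bound"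
    and extrapolation_cost_le: "measure_pmf.expectation batch (extrapolation_cost z)
      \<le> variance_bound + 9 * (L * diameter C)\<^sup>2"
proof -
  have bound: "norm (batch_mean Fi s z) \<le> L * diameter C + norm (batch_mean Fi s xstar)" for s
  proof -
    have "norm (batch_mean Fi s z - batch_mean Fi s xstar) \<le> L * norm (z - xstar)"
      using lipschitz_onD[OF lipschitz_batch, of z xstar] by (simp add: dist_norm)
    also have "\<dots> \<le> L * diameter C"
      using dist_C[OF assms zero(1)] L_pos by simp
    finally show ?thesis
      using norm_triangle_sub[of "batch_mean Fi s z" "batch_mean Fi s xstar"] by linarith
  qed
  note bounds = estimate_moment_bounds[OF finite_batch batch_unbiased bound]
  show "measure_pmf.expectation batch (\<lambda>s. (norm (noise z s))\<^sup>2) \<le> variance_bound"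
    unfolding noise_def variance_bound_def
    using L_pos diameter_C_nonneg by (intro bounds(1)) auto
  show "measure_pmf.expectation batch (extrapolation_cost z) \<le> variance_bound + 9 * (L * diameter C)\<^sup>2"
    unfolding extrapolation_cost_def variance_bound_def
    using L_pos diameter_C_nonneg by (intro bounds(2)) auto
qed

lemma Fi_measurable: "Fi i \<in> borel_measurable borel"
  using Fi_lipschitz by (intro borel_measurable_continuous_onI lipschitz_on_continuous_on)

lemma x_adapted: "x k \<in> borel_measurable (\<F> k)"
  unfolding x_eq[abs_def] using Fi_measurable by (rule seg_iterate_adapted)

lemma alpha_measurable [measurable]: "\<alpha> k \<in> borel_measurable M"
  unfolding alpha_eq[abs_def] using Fi_measurable by (rule seg_alpha_measurable)

lemma sampled_measurable:
  fixes f :: "'a \<Rightarrow> nat list \<Rightarrow> 'c::{second_countable_topology, t2_space}"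
  assumes "\<And>s. continuous_on UNIV (\<lambda>z. f z s)"
  shows "(\<lambda>\<omega>. f (x k \<omega>) (S k \<omega>)) \<in> borel_measurable (\<F> (Suc k))"
proof (rule measurable_compose_countable[OF _ batch_adapted])
  have "x k \<in> borel_measurable (\<F> (Suc k))"
    by (rule measurable_later[OF x_adapted]) simp
  then show "(\<lambda>\<omega>. f (x k \<omega>) s) \<in> borel_measurable (\<F> (Suc k))" for s
    by (rule measurable_compose[OF _ borel_measurable_continuous_onI[OF assms]])
qed

text \<open>
  Iterates range over a compact set and mini-batches over a finite one. All integrability below
  comes from this.
\<close>

lemma sampled_bounded:
  fixes f :: "'a \<Rightarrow> nat list \<Rightarrow> 'c::real_normed_vector"
  assumes "\<And>s. continuous_on UNIV (\<lambda>z. f z s)"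
  obtains B where "AE \<omega> in M. \<forall>k. norm (f (x k \<omega>) (S k \<omega>)) \<le> B"
proof -
  have "bounded (\<Union>s\<in>set_pmf batch. (\<lambda>z. f z s) ` C)"
    using finite_batch C_compact assms
    by (intro bounded_UN ballI compact_imp_bounded compact_continuous_image)
       (auto intro: continuous_on_subset)
  then obtain B where B: "\<And>z s. z \<in> C \<Longrightarrow> s \<in> set_pmf batch \<Longrightarrow> norm (f z s) \<le> B"
    unfolding bounded_iff by auto
  have "AE \<omega> in M. \<forall>k. norm (f (x k \<omega>) (S k \<omega>)) \<le> B"
    using run_in_C AE_batch_in_support by eventually_elim (auto intro: B)
  then show ?thesis by (rule that)
qed

lemma sampled_integrable:
  fixes f :: "'a \<Rightarrow> nat list \<Rightarrow> real"
  assumes "\<And>s. continuous_on UNIV (\<lambda>z. f z s)"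
  shows "integrable M (\<lambda>\<omega>. f (x k \<omega>) (S k \<omega>))"
proof -
  obtain B where "AE \<omega> in M. \<forall>k. norm (f (x k \<omega>) (S k \<omega>)) \<le> B"
    using sampled_bounded[of f, OF assms] by blast
  then have "AE \<omega> in M. norm (f (x k \<omega>) (S k \<omega>)) \<le> B"
    by (rule AE_mp) auto
  then show ?thesis
    by (rule integrable_const_bound) (rule measurable_past[OF sampled_measurable[of f, OF assms]])
qed

lemma sampled_expectation_le:
  fixes f :: "'a \<Rightarrow> nat list \<Rightarrow> real"
  assumes cont: "\<And>s. continuous_on UNIV (\<lambda>z. f z s)"
    and le: "\<And>z. z \<in> C \<Longrightarrow> measure_pmf.expectation batch (f z) \<le> V"
  shows "expectation (\<lambda>\<omega>. f (x k \<omega>) (S k \<omega>)) \<le> V"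
proof -
  let ?E = "\<lambda>z. measure_pmf.expectation batch (f z)"
  have E_cont: "continuous_on UNIV ?E"
  proof -
    have "?E = (\<lambda>z. \<Sum>s\<in>set_pmf batch. pmf batch s *\<^sub>R f z s)"
      by (rule ext, rule integral_measure_pmf) (auto simp: finite_batch)
    then show ?thesis
      by (simp only:) (intro continuous_on_sum continuous_on_scaleR continuous_on_const cont)
  qed
  have "expectation (\<lambda>\<omega>. f (x k \<omega>) (S k \<omega>)) = expectation (\<lambda>\<omega>. ?E (x k \<omega>))"
    by (rule expectation_fresh_batch[OF x_adapted borel_measurable_continuous_onI[OF cont]
          sampled_integrable[of f, OF cont]])
  also have "\<dots> \<le> expectation (\<lambda>\<omega>. V)"
  proof (rule integral_mono_AE)
    show "integrable M (\<lambda>\<omega>. ?E (x k \<omega>))"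
      using sampled_integrable[of "\<lambda>z s. ?E z", OF E_cont] .
    show "AE \<omega> in M. ?E (x k \<omega>) \<le> V"
      using run_in_C by eventually_elim (auto intro: le)
  qed simp
  finally show ?thesis by (simp add: prob_space)
qed

text \<open>
  Averaging over the new mini-batch with the pair \<open>(Y, x k)\<close> held fixed annihilates the noise,
  because the batch mean is unbiased at every fixed point.
\<close>

lemma noise_orthogonal_to_past:
  fixes Y :: "'w \<Rightarrow> 'a"
  assumes Y: "Y \<in> borel_measurable (\<F> k)" and Y_bounded: "AE \<omega> in M. norm (Y \<omega>) \<le> B"
  shows "integrable M (\<lambda>\<omega>. Y \<omega> \<bullet> noise (x k \<omega>) (S k \<omega>))"
    and "expectation (\<lambda>\<omega>. Y \<omega> \<bullet> noise (x k \<omega>) (S k \<omega>)) = 0"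
proof -
  obtain B' where B': "AE \<omega> in M. \<forall>k. norm (noise (x k \<omega>) (S k \<omega>)) \<le> B'"
    using sampled_bounded[of noise, OF continuous_noise] by blast
  have [measurable]: "Y \<in> borel_measurable M"
      "(\<lambda>\<omega>. noise (x k \<omega>) (S k \<omega>)) \<in> borel_measurable M"
    by (rule measurable_past[OF Y], rule measurable_past[OF sampled_measurable[of noise, OF continuous_noise]])
  show int: "integrable M (\<lambda>\<omega>. Y \<omega> \<bullet> noise (x k \<omega>) (S k \<omega>))"
  proof (rule integrable_const_bound[where B="B * B'"])
    show "AE \<omega> in M. norm (Y \<omega> \<bullet> noise (x k \<omega>) (S k \<omega>)) \<le> B * B'"
      using Y_bounded B'
    proof eventually_elim
      case (elim \<omega>)
      have "\<bar>Y \<omega> \<bullet> noise (x k \<omega>) (S k \<omega>)\<bar> \<le> norm (Y \<omega>) * norm (noise (x k \<omega>) (S k \<omega>))"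
        by (rule Cauchy_Schwarz_ineq2)
      also have "\<dots> \<le> B * B'"
        using elim order_trans[OF norm_ge_zero] by (intro mult_mono) auto
      finally show ?case by simp
    qed
  qed measurable
  have mean_noise: "measure_pmf.expectation batch (\<lambda>s. y \<bullet> noise z s) = 0" for y z
  proof -
    have "measure_pmf.expectation batch (\<lambda>s. y \<bullet> noise z s)
        = y \<bullet> (F z - measure_pmf.expectation batch (\<lambda>s. batch_mean Fi s z))"
      unfolding noise_def by (simp add: integrable_measure_pmf_finite[OF finite_batch])
    then show ?thesis by (simp add: batch_unbiased)
  qed
  have "(\<lambda>\<omega>. (Y \<omega>, x k \<omega>)) \<in> measurable (\<F> k) (borel \<Otimes>\<^sub>M borel)"
    using Y x_adapted by measurable
  moreover have "(\<lambda>w. fst w \<bullet> noise (snd w) s) \<in> borel_measurable (borel \<Otimes>\<^sub>M borel)" for s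
  proof -
    have [measurable]: "(\<lambda>z. noise z s) \<in> borel_measurable borel"
      using continuous_noise by (rule borel_measurable_continuous_onI)
    show ?thesis by measurable
  qed
  ultimately have "expectation (\<lambda>\<omega>. fst (Y \<omega>, x k \<omega>) \<bullet> noise (snd (Y \<omega>, x k \<omega>)) (S k \<omega>))
      = expectation (\<lambda>\<omega>. measure_pmf.expectation batch
          (\<lambda>s. fst (Y \<omega>, x k \<omega>) \<bullet> noise (snd (Y \<omega>, x k \<omega>)) s))"
    using int by (intro expectation_fresh_batch[where f="\<lambda>w s. fst w \<bullet> noise (snd w) s"]) simp_all
  then show "expectation (\<lambda>\<omega>. Y \<omega> \<bullet> noise (x k \<omega>) (S k \<omega>)) = 0"
    by (simp add: mean_noise)
qed

definition total_noise :: "nat \<Rightarrow> 'w \<Rightarrow> 'a" where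
  "total_noise m \<omega> = (\<Sum>k<m. noise (x k \<omega>) (S k \<omega>))"

lemma total_noise_adapted: "total_noise m \<in> borel_measurable (\<F> m)"
  unfolding total_noise_def[abs_def]
proof (rule borel_measurable_sum)
  show "(\<lambda>\<omega>. noise (x k \<omega>) (S k \<omega>)) \<in> borel_measurable (\<F> m)" if "k \<in> {..<m}" for k
    using that by (intro measurable_later[OF sampled_measurable[of noise, OF continuous_noise]]) simp
qed

lemma total_noise_bounded:
  obtains B where "AE \<omega> in M. norm (total_noise m \<omega>) \<le> B"
proof -
  obtain B where "AE \<omega> in M. \<forall>k. norm (noise (x k \<omega>) (S k \<omega>)) \<le> B"
    using sampled_bounded[of noise, OF continuous_noise] by blast
  then have "AE \<omega> in M. norm (total_noise m \<omega>) \<le> (\<Sum>k<m. B)"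
    unfolding total_noise_def by eventually_elim (intro sum_norm_le, simp)
  then show ?thesis by (rule that)
qed

lemma total_noise_integrable:
  shows "integrable M (\<lambda>\<omega>. (norm (total_noise m \<omega>))\<^sup>2)"
    and "integrable M (\<lambda>\<omega>. norm (total_noise m \<omega>))"
proof -
  have [measurable]: "total_noise m \<in> borel_measurable M"
    using total_noise_adapted by (rule measurable_past)
  obtain B where B: "AE \<omega> in M. norm (total_noise m \<omega>) \<le> B"
    using total_noise_bounded by blast
  show "integrable M (\<lambda>\<omega>. norm (total_noise m \<omega>))"
    using B by (intro integrable_const_bound[where B=B]) auto
  have "AE \<omega> in M. norm ((norm (total_noise m \<omega>))\<^sup>2) \<le> B\<^sup>2"
    using B by eventually_elim (simp add: power_mono)
  then show "integrable M (\<lambda>\<omega>. (norm (total_noise m \<omega>))\<^sup>2)"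
    by (rule integrable_const_bound) measurable
qed

text \<open>
  The cross term between the accumulated noise and the next increment has mean zero.
\<close>

lemma total_noise_second_moment_le:
  "expectation (\<lambda>\<omega>. (norm (total_noise m \<omega>))\<^sup>2) \<le> real m * variance_bound"
proof (induction m)
  case (Suc m)
  let ?\<xi> = "\<lambda>\<omega>. noise (x m \<omega>) (S m \<omega>)"
  obtain B where B: "AE \<omega> in M. norm (total_noise m \<omega>) \<le> B"
    using total_noise_bounded by blast
  note orth = noise_orthogonal_to_past[OF total_noise_adapted B]
  have cont: "continuous_on UNIV (\<lambda>z. (norm (noise z s))\<^sup>2)" for s
    by (intro continuous_intros continuous_noise)
  have "(norm (total_noise (Suc m) \<omega>))\<^sup>2
      = (norm (total_noise m \<omega>))\<^sup>2 + 2 * (total_noise m \<omega> \<bullet> ?\<xi> \<omega>) + (norm (?\<xi> \<omega>))\<^sup>2" for \<omega>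
    unfolding power2_norm_eq_inner total_noise_def sum.lessThan_Suc by (simp add: inner_add inner_commute)
  then have "expectation (\<lambda>\<omega>. (norm (total_noise (Suc m) \<omega>))\<^sup>2)
      = expectation (\<lambda>\<omega>. (norm (total_noise m \<omega>))\<^sup>2) + expectation (\<lambda>\<omega>. (norm (?\<xi> \<omega>))\<^sup>2)"
    using orth total_noise_integrable(1)[of m]
      sampled_integrable[where f="\<lambda>z s. (norm (noise z s))\<^sup>2" and k=m, OF cont] by simp
  also have "\<dots> \<le> real m * variance_bound + variance_bound"
    by (intro add_mono Suc.IH sampled_expectation_le[where f="\<lambda>z s. (norm (noise z s))\<^sup>2", OF cont noise_variance_le])
  finally show ?case by (simp add: algebra_simps)
qed (simp add: total_noise_def)

lemma expectation_norm_total_noise_le: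
  "expectation (\<lambda>\<omega>. norm (total_noise m \<omega>)) \<le> sqrt (real m * variance_bound)"
proof (rule real_le_rsqrt)
  let ?X = "\<lambda>\<omega>. norm (total_noise m \<omega>)"
  have "(expectation ?X)\<^sup>2 \<le> expectation (\<lambda>\<omega>. (?X \<omega>)\<^sup>2)"
    using variance_positive[of ?X] total_noise_integrable[of m] by (simp add: variance_eq)
  then show "(expectation ?X)\<^sup>2 \<le> real m * variance_bound"
    using total_noise_second_moment_le order_trans by blast
qed

end

section \<open>The convergence rate\<close>

text \<open>
  One step of the induction is \<open>1 / b \<le> 2 * (b - a)\<close> for consecutive square roots \<open>a < b\<close>, which is
  \<open>0 \<le> (b - a)\<^sup>2\<close> because \<open>b\<^sup>2 = a\<^sup>2 + 1\<close>.
\<close>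

lemma sum_inverse_sqrt_le: "(\<Sum>k\<le>K. 1 / sqrt (real k + 1)) \<le> 2 * sqrt (real K + 1)"
proof (induction K)
  case (Suc K)
  let ?a = "sqrt (real K + 1)" and ?b = "sqrt (real (Suc K) + 1)"
  have sq: "?b * ?b = ?a * ?a + 1" by simp
  have "2 * ?a * ?b \<le> ?a * ?a + ?b * ?b"
    using zero_le_square[of "?a - ?b"] by (simp add: algebra_simps)
  moreover have "(2 * ?a + 1 / ?b) * ?b = 2 * ?a * ?b + 1"
    by (simp add: distrib_right)
  ultimately have "(2 * ?a + 1 / ?b) * ?b \<le> (2 * ?b) * ?b"
    using sq by linarith
  then have "2 * ?a + 1 / ?b \<le> 2 * ?b"
    by (rule mult_right_le_imp_le) simp
  with Suc show ?case by simp
qed simp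

context confined_seg_run
begin

text \<open>
  What separates the gap of \<open>F\<close> from the sampled gap: a martingale part, the price for testing the
  noise against a sample-dependent point instead of \<open>xstar\<close>, and the price for extrapolating.
\<close>

definition error_term :: "nat \<Rightarrow> 'w \<Rightarrow> real" where
  "error_term K \<omega> = (\<Sum>k\<le>K. (x k \<omega> - xstar) \<bullet> noise (x k \<omega>) (S k \<omega>))
     + 3 / 2 * diameter C * norm (total_noise (Suc K) \<omega>)
     + (\<Sum>k\<le>K. \<gamma>_init / c k * extrapolation_cost (x k \<omega>) (S k \<omega>))"

lemma average_in_C:
  fixes K :: nat
  assumes "\<And>k. y k \<in> C"
  shows "(1 / (real K + 1)) *\<^sub>R (\<Sum>k\<le>K. y k) \<in> C"
proof -
  have "(\<Sum>k\<le>K. (1 / (real K + 1)) *\<^sub>R y k) \<in> C"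
    using assms by (intro convex_sum C_convex) (auto simp: field_simps)
  then show ?thesis by (simp add: scaleR_sum_right)
qed

text \<open>
  Combines the three pathwise estimates at the comparison point of \<open>residual_le_gap\<close>. This point
  may leave \<open>C\<close>, but only by \<open>diameter C / 2\<close>, as \<open>\<parallel>F xbar\<parallel> \<le> L * diameter C\<close>.
\<close>

lemma residual_le_pathwise:
  "AE \<omega> in M. (norm (F ((1 / (real K + 1)) *\<^sub>R (\<Sum>k\<le>K. xh k \<omega>))))\<^sup>2
    \<le> 4 * L * (1 / (real K + 1) * (9 * (diameter C)\<^sup>2 / (8 * \<alpha> K \<omega>) + error_term K \<omega>))"
  and alpha_pos: "AE \<omega> in M. 0 < \<alpha> K \<omega>"
proof -
  let ?D = "diameter C"
  let ?\<Phi> = "\<lambda>\<omega> j. batch_mean Fi (S j \<omega>)"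
  have "AE \<omega> in M. 0 < \<alpha> K \<omega> \<and> (norm (F ((1 / (real K + 1)) *\<^sub>R (\<Sum>k\<le>K. xh k \<omega>))))\<^sup>2
    \<le> 4 * L * (1 / (real K + 1) * (9 * ?D\<^sup>2 / (8 * \<alpha> K \<omega>) + error_term K \<omega>))"
    using critical run_in_C step_size_le
  proof eventually_elim
    case (elim \<omega>)
    note steps = elim(3)[unfolded mult_1]
    define xbar where "xbar = (1 / (real K + 1)) *\<^sub>R (\<Sum>k\<le>K. xh k \<omega>)"
    define z where "z = xbar - (1 / (2 * L)) *\<^sub>R F xbar"
    have xbar: "xbar \<in> C"
      unfolding xbar_def using elim(2) by (intro average_in_C) simp
    have "norm (F xbar) \<le> L * norm (xbar - xstar)"
      using lipschitz_onD[OF lipschitz_F, of xbar xstar] zero(2) by (simp add: dist_norm)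
    also have "\<dots> \<le> L * ?D"
      using dist_C[OF xbar zero(1)] L_pos by simp
    finally have "norm (xbar - z) \<le> ?D / 2"
      using L_pos by (simp add: z_def field_simps)
    then have near: "norm (y - z) \<le> 3 / 2 * ?D" if "y \<in> C" for y
      using dist_C[OF that xbar] norm_triangle_ineq[of "y - xbar" "xbar - z"] by simp
    have regret: "(\<Sum>k\<le>K. ?\<Phi> \<omega> k (xh k \<omega>) \<bullet> (xh k \<omega> - z)) \<le> (3 / 2 * ?D)\<^sup>2 / (2 * \<alpha> K \<omega>)"
      using elim(1,2) steps near A_less_1 unfolding x_eq xh_eq alpha_eq
      by (intro seg_regret_le[where A=A]) auto
    have pos: "0 < \<alpha> K \<omega>"
      using elim(1) steps A_less_1 unfolding x_eq xh_eq alpha_eq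
      by (intro seg_alpha_pos[where A=A]) auto
    have xh: "xh k \<omega> = x k \<omega> - \<gamma> k \<omega> *\<^sub>R ?\<Phi> \<omega> k (x k \<omega>)" for k
      by (simp add: x_eq xh_eq seg_extrapolated_def)
    have "F (xh k \<omega>) \<bullet> (xh k \<omega> - z) \<le> ?\<Phi> \<omega> k (xh k \<omega>) \<bullet> (xh k \<omega> - z)
        + noise (x k \<omega>) (S k \<omega>) \<bullet> (x k \<omega> - z)
        + \<gamma>_init / c k * extrapolation_cost (x k \<omega>) (S k \<omega>)" for k
      using inner_oracle_error_le[OF lipschitz_F lipschitz_batch[of "S k \<omega>"],
          of "x k \<omega>" "\<gamma> k \<omega>" z "3 / 2 * ?D" "\<gamma>_init / c k"]
        near[of "xh k \<omega>"] elim(2) steps[rule_format, of k]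
      unfolding noise_def extrapolation_cost_def xh by simp
    then have "(\<Sum>k\<le>K. F (xh k \<omega>) \<bullet> (xh k \<omega> - z)) \<le> (\<Sum>k\<le>K. ?\<Phi> \<omega> k (xh k \<omega>) \<bullet> (xh k \<omega> - z)
        + noise (x k \<omega>) (S k \<omega>) \<bullet> (x k \<omega> - z)
        + \<gamma>_init / c k * extrapolation_cost (x k \<omega>) (S k \<omega>))"
      by (rule sum_mono)
    also have "\<dots> = (\<Sum>k\<le>K. ?\<Phi> \<omega> k (xh k \<omega>) \<bullet> (xh k \<omega> - z))
        + (\<Sum>k\<le>K. noise (x k \<omega>) (S k \<omega>) \<bullet> (x k \<omega> - z))
        + (\<Sum>k\<le>K. \<gamma>_init / c k * extrapolation_cost (x k \<omega>) (S k \<omega>))"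
      by (simp only: sum.distrib)
    also have "(\<Sum>k\<le>K. noise (x k \<omega>) (S k \<omega>) \<bullet> (x k \<omega> - z))
        = (\<Sum>k\<le>K. (x k \<omega> - xstar) \<bullet> noise (x k \<omega>) (S k \<omega>)) + total_noise (Suc K) \<omega> \<bullet> (xstar - z)"
    proof -
      have "noise (x k \<omega>) (S k \<omega>) \<bullet> (x k \<omega> - z)
          = (x k \<omega> - xstar) \<bullet> noise (x k \<omega>) (S k \<omega>) + noise (x k \<omega>) (S k \<omega>) \<bullet> (xstar - z)" for k
        by (simp add: inner_diff inner_commute)
      then show ?thesis
        by (simp only: sum.distrib total_noise_def inner_sum_left lessThan_Suc_atMost)
    qed
    also have "total_noise (Suc K) \<omega> \<bullet> (xstar - z) \<le> norm (total_noise (Suc K) \<omega>) * (3 / 2 * ?D)"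
      using near[OF zero(1)] norm_cauchy_schwarz[of "total_noise (Suc K) \<omega>" "xstar - z"]
      by (meson mult_left_mono norm_ge_zero order_trans)
    finally have "(\<Sum>k\<le>K. F (xh k \<omega>) \<bullet> (xh k \<omega> - z))
        \<le> 9 * ?D\<^sup>2 / (8 * \<alpha> K \<omega>) + error_term K \<omega>"
      using regret by (simp add: error_term_def power2_eq_square mult_ac)
    then have "4 * L * (1 / (real K + 1) * (\<Sum>k\<le>K. F (xh k \<omega>) \<bullet> (xh k \<omega> - z)))
        \<le> 4 * L * (1 / (real K + 1) * (9 * ?D\<^sup>2 / (8 * \<alpha> K \<omega>) + error_term K \<omega>))"
      using L_pos by (intro mult_left_mono) auto
    with residual_le_gap[OF F_monotone lipschitz_F L_pos, of K "\<lambda>k. xh k \<omega>"] pos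
    show ?case unfolding z_def xbar_def by linarith
  qed
  then show "AE \<omega> in M. (norm (F ((1 / (real K + 1)) *\<^sub>R (\<Sum>k\<le>K. xh k \<omega>))))\<^sup>2
    \<le> 4 * L * (1 / (real K + 1) * (9 * ?D\<^sup>2 / (8 * \<alpha> K \<omega>) + error_term K \<omega>))"
    and "AE \<omega> in M. 0 < \<alpha> K \<omega>"
    by (eventually_elim, simp)+
qed

lemma error_term_integrable: "integrable M (error_term K)"
  and expectation_error_term_le:
    "0 \<le> \<gamma>_init \<Longrightarrow> expectation (error_term K) \<le> 3 / 2 * diameter C * sqrt (real (Suc K) * variance_bound)
      + (\<Sum>k\<le>K. \<gamma>_init / c k) * (variance_bound + 9 * (L * diameter C)\<^sup>2)"
proof -
  let ?D = "diameter C"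
  define mart where "mart k \<omega> = (x k \<omega> - xstar) \<bullet> noise (x k \<omega>) (S k \<omega>)" for k \<omega>
  define cost where "cost k \<omega> = extrapolation_cost (x k \<omega>) (S k \<omega>)" for k \<omega>
  have mart: "integrable M (mart k)" "expectation (mart k) = 0" for k
  proof -
    have meas: "(\<lambda>\<omega>. x k \<omega> - xstar) \<in> borel_measurable (\<F> k)"
      using x_adapted by measurable
    have bnd: "AE \<omega> in M. norm (x k \<omega> - xstar) \<le> ?D"
      using run_in_C by eventually_elim (simp add: dist_C zero)
    show "integrable M (mart k)" "expectation (mart k) = 0"
      unfolding mart_def using noise_orthogonal_to_past[OF meas bnd] by auto
  qed
  have cost: "integrable M (cost k)"
      "expectation (cost k) \<le> variance_bound + 9 * (L * ?D)\<^sup>2" for k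
    unfolding cost_def
    by (rule sampled_integrable[of extrapolation_cost, OF continuous_extrapolation_cost],
        rule sampled_expectation_le[of extrapolation_cost, OF continuous_extrapolation_cost extrapolation_cost_le])
  have split: "error_term K = (\<lambda>\<omega>. (\<Sum>k\<le>K. mart k \<omega>) + 3 / 2 * ?D * norm (total_noise (Suc K) \<omega>)
      + (\<Sum>k\<le>K. \<gamma>_init / c k * cost k \<omega>))"
    by (simp add: error_term_def mart_def cost_def fun_eq_iff)
  note [simp] = mart cost(1) total_noise_integrable(2)
  show "integrable M (error_term K)"
    unfolding split by simp
  assume "0 \<le> \<gamma>_init"
  have "expectation (error_term K) = 3 / 2 * ?D * expectation (\<lambda>\<omega>. norm (total_noise (Suc K) \<omega>))
      + (\<Sum>k\<le>K. \<gamma>_init / c k * expectation (cost k))"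
    unfolding split by simp
  also have "\<dots> \<le> 3 / 2 * ?D * sqrt (real (Suc K) * variance_bound)
      + (\<Sum>k\<le>K. \<gamma>_init / c k * (variance_bound + 9 * (L * ?D)\<^sup>2))"
    using diameter_C_nonneg \<open>0 \<le> \<gamma>_init\<close> c_pos(2)
    by (intro add_mono mult_left_mono sum_mono expectation_norm_total_noise_le cost(2))
       (auto simp: less_imp_le)
  finally show "expectation (error_term K) \<le> 3 / 2 * ?D * sqrt (real (Suc K) * variance_bound)
      + (\<Sum>k\<le>K. \<gamma>_init / c k) * (variance_bound + 9 * (L * ?D)\<^sup>2)"
    by (simp add: sum_distrib_right)
qed

text \<open>
  The error term may be negative, so the pathwise bound is integrated with the Bochner integral;
  this requires \<open>9 * D\<^sup>2 / (8 * \<alpha> K)\<close> to be integrable, and otherwise the right-hand side is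
  infinite.
\<close>

lemma residual_rate:
  assumes c_eq: "\<And>k. c k = sqrt (real k + 1)" and \<gamma>_init: "0 < \<gamma>_init" and "0 < A"
    and \<sigma>: "0 \<le> \<sigma>" "\<sigma>\<^sup>2 = variance_bound"
  defines "D \<equiv> diameter C"
  shows "(\<integral>\<^sup>+ \<omega>. ennreal ((norm (F ((1 / (real K + 1)) *\<^sub>R (\<Sum>k\<le>K. xh k \<omega>))))\<^sup>2) \<partial>M)
     \<le> ennreal (4 * L) *
        (ennreal (1 / (real K + 1)) * (\<integral>\<^sup>+ \<omega>. ennreal (9 * D\<^sup>2 / (8 * \<alpha> K \<omega>)) \<partial>M)
         + ennreal (3 * \<sigma> * D / (2 * sqrt (real K + 1)))
         + ennreal (2 * \<gamma>_init / ((1 - A) * sqrt (real K + 1)) * (\<sigma>\<^sup>2 + 9 * L\<^sup>2 * D\<^sup>2)))"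
    (is "?lhs \<le> ennreal (4 * L) * (ennreal ?w * ?I + ennreal ?t1 + ennreal ?t2)")
proof (cases "?I = \<infinity>")
  case True
  then show ?thesis
    using L_pos by (simp add: ennreal_mult_top)
next
  case False
  let ?G = "\<lambda>\<omega>. 9 * D\<^sup>2 / (8 * \<alpha> K \<omega>)" and ?s = "sqrt (real K + 1)"
  have D: "0 \<le> D" unfolding D_def by (rule diameter_C_nonneg)
  have G_nonneg: "AE \<omega> in M. 0 \<le> ?G \<omega>"
    using alpha_pos[of K] by eventually_elim simp
  have G_int: "integrable M ?G"
    using False G_nonneg by (intro integrableI_nonneg) (auto simp: top.not_eq_extremum)
  have I_eq: "?I = ennreal (expectation ?G)"
    using G_int G_nonneg by (rule nn_integral_eq_integral)
  have error: "?w * expectation (error_term K) \<le> ?t1 + ?t2"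
  proof -
    let ?V = "\<sigma>\<^sup>2 + 9 * L\<^sup>2 * D\<^sup>2"
    have s: "0 < ?s" by simp
    have "expectation (error_term K) \<le> 3 / 2 * D * (?s * \<sigma>) + (\<Sum>k\<le>K. \<gamma>_init / c k) * ?V"
    proof -
      have "sqrt (real (Suc K) * variance_bound) = ?s * \<sigma>"
        unfolding \<sigma>(2)[symmetric] using \<sigma>(1) by (simp add: real_sqrt_mult add.commute)
      moreover have "variance_bound + 9 * (L * diameter C)\<^sup>2 = ?V"
        unfolding \<sigma>(2) D_def by (simp add: power_mult_distrib)
      ultimately show ?thesis
        using expectation_error_term_le[of K] \<gamma>_init unfolding D_def by simp
    qed
    also have "(\<Sum>k\<le>K. \<gamma>_init / c k) = \<gamma>_init * (\<Sum>k\<le>K. 1 / sqrt (real k + 1))"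
      by (simp add: c_eq sum_distrib_left)
    also have "\<gamma>_init * (\<Sum>k\<le>K. 1 / sqrt (real k + 1)) * ?V \<le> \<gamma>_init * (2 * ?s) * ?V"
      using \<gamma>_init by (intro mult_right_mono mult_left_mono sum_inverse_sqrt_le) auto
    finally have "?w * expectation (error_term K) \<le> ?w * (3 / 2 * D * (?s * \<sigma>) + \<gamma>_init * (2 * ?s) * ?V)"
      by (intro mult_left_mono) auto
    also have "\<dots> = ?t1 + 2 * \<gamma>_init / ?s * ?V"
    proof -
      have "1 / r * (3 / 2 * D * (s * \<sigma>) + \<gamma>_init * (2 * s) * ?V)
          = 3 * \<sigma> * D / (2 * s) + 2 * \<gamma>_init / s * ?V" if "0 < s" "r = s * s" for r s :: real
        using that by (simp add: field_simps)
      from this[of ?s "real K + 1"] show ?thesis using s by simp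
    qed
    also have "2 * \<gamma>_init / ?s * ?V \<le> ?t2"
    proof -
      have "(1 - A) * ?s \<le> ?s"
        using s \<open>0 < A\<close> by simp
      then show ?thesis
        using \<gamma>_init A_less_1 by (intro mult_right_mono divide_left_mono) auto
    qed
    finally show ?thesis by simp
  qed
  have bound: "AE \<omega> in M. (norm (F ((1 / (real K + 1)) *\<^sub>R (\<Sum>k\<le>K. xh k \<omega>))))\<^sup>2
      \<le> 4 * L * (?w * (?G \<omega> + error_term K \<omega>))"
    using residual_le_pathwise[of K] by (simp add: D_def)
  have "?lhs \<le> (\<integral>\<^sup>+ \<omega>. ennreal (4 * L * (?w * (?G \<omega> + error_term K \<omega>))) \<partial>M)"
    using bound by (intro nn_integral_mono_AE) (auto elim!: eventually_mono intro: ennreal_leI)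
  also have "\<dots> = ennreal (expectation (\<lambda>\<omega>. 4 * L * (?w * (?G \<omega> + error_term K \<omega>))))"
  proof (rule nn_integral_eq_integral)
    show "AE \<omega> in M. 0 \<le> 4 * L * (?w * (?G \<omega> + error_term K \<omega>))"
      using bound by eventually_elim (rule order_trans[OF zero_le_power2])
  qed (intro integrable_mult_right Bochner_Integration.integrable_add G_int error_term_integrable)
  also have "\<dots> = ennreal (4 * L * (?w * expectation ?G + ?w * expectation (error_term K)))"
    by (simp only: Bochner_Integration.integral_add[OF G_int error_term_integrable]
        integral_mult_right_zero) (simp only: distrib_left)
  also have "\<dots> \<le> ennreal (4 * L * (?w * expectation ?G + (?t1 + ?t2)))"
    using error L_pos by (intro ennreal_leI mult_left_mono add_left_mono) auto
  also have "\<dots> = ennreal (4 * L) * (ennreal ?w * ?I + ennreal ?t1 + ennreal ?t2)"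
  proof -
    have nonneg: "0 \<le> expectation ?G" "0 \<le> ?t1" "0 \<le> ?t2" "0 \<le> 4 * L" "0 \<le> ?w"
      using G_nonneg D \<sigma>(1) \<gamma>_init A_less_1 L_pos by (auto intro: integral_nonneg_AE)
    have "ennreal (l * (w * e + (t + u))) = ennreal l * (ennreal w * ennreal e + ennreal t + ennreal u)"
      if "0 \<le> e" "0 \<le> t" "0 \<le> u" "0 \<le> l" "0 \<le> w" for l w e t u :: real
      using that by (simp add: ennreal_mult add.assoc)
    from this[OF nonneg] show ?thesis
      unfolding I_eq .
  qed
  finally show ?thesis .
qed

end

text \<open>
  Only the maps \<open>Fi i\<close> with \<open>i\<close> in \<open>{1..n}\<close> are assumed Lipschitz, and the others need not be
  measurable. Replacing these by zero changes the run on a null set at most.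
\<close>

theorem theorem4p6:
  fixes M :: "'w measure" and \<F> :: "nat \<Rightarrow> 'w measure"
    and n b :: nat and S :: "nat \<Rightarrow> 'w \<Rightarrow> nat list"
    and Fi :: "nat \<Rightarrow> 'a \<Rightarrow> 'a::euclidean_space" and F :: "'a \<Rightarrow> 'a"
    and L A D \<sigma> \<gamma>_init :: real and c :: "nat \<Rightarrow> real"
    and \<gamma> \<alpha> :: "nat \<Rightarrow> 'w \<Rightarrow> real" and x xh :: "nat \<Rightarrow> 'w \<Rightarrow> 'a"
    and x0 xstar :: 'a and C :: "'a set" and K :: nat
  assumes sampling_and_steps: "dec_polyak_seg_setup M \<F> n b S 1 c \<gamma>_init \<gamma>"
    and c_eq: "\<And>k. c k = sqrt (real k + 1)"
    and gamma_init_pos: "0 < \<gamma>_init"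
    and F_eq: "\<And>z. F z = (1 / real n) *\<^sub>R (\<Sum>i=1..n. Fi i z)"
    and L_pos: "0 < L"
    and Fi_lipschitz: "\<And>i. i \<in> {1..n} \<Longrightarrow> L-lipschitz_on UNIV (Fi i)"
    and F_monotone: "monotone_operator F"
    and x_eq: "\<And>k \<omega>. x k \<omega> =
          seg_iterate (\<lambda>j. batch_mean Fi (S j \<omega>)) (\<lambda>j. \<gamma> j \<omega>) x0 k"
    and xh_eq: "\<And>k \<omega>. xh k \<omega> =
          seg_extrapolated (\<lambda>j. batch_mean Fi (S j \<omega>)) (\<lambda>j. \<gamma> j \<omega>) x0 k"
    and alpha_eq: "\<And>k \<omega>. \<alpha> k \<omega> =
          seg_alpha (\<lambda>j. batch_mean Fi (S j \<omega>)) (\<lambda>j. \<gamma> j \<omega>) x0 k"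
    and A_range: "0 < A" "A < 1"
    and critical: "AE \<omega> in M. \<forall>k.
          norm (batch_mean Fi (S k \<omega>) (xh k \<omega>) - batch_mean Fi (S k \<omega>) (x k \<omega>))
            \<le> A * norm (batch_mean Fi (S k \<omega>) (x k \<omega>))"
    and C_compact: "compact C" and C_convex: "convex C" and D_eq: "D = diameter C"
    and zero: "xstar \<in> C" "F xstar = 0"
    and run_in_C: "AE \<omega> in M. \<forall>k. x k \<omega> \<in> C \<and> xh k \<omega> \<in> C"
    and sigma_nonneg: "0 \<le> \<sigma>"
    and sigma_sq: "\<sigma>\<^sup>2 = 2 * L\<^sup>2 * D\<^sup>2
          + 2 * measure_pmf.expectation (minibatch_pmf n b) (\<lambda>s. (norm (batch_mean Fi s xstar))\<^sup>2)"
  shows "(\<integral>\<^sup>+ \<omega>. ennreal ((norm (F ((1 / (real K + 1)) *\<^sub>R (\<Sum>k=0..K. xh k \<omega>))))\<^sup>2) \<partial>M)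
     \<le> ennreal (4 * L) *
        (ennreal (1 / (real K + 1)) * (\<integral>\<^sup>+ \<omega>. ennreal (9 * D\<^sup>2 / (8 * \<alpha> K \<omega>)) \<partial>M)
         + ennreal (3 * \<sigma> * D / (2 * sqrt (real K + 1)))
         + ennreal (2 * \<gamma>_init / ((1 - A) * sqrt (real K + 1)) * (\<sigma>\<^sup>2 + 9 * L\<^sup>2 * D\<^sup>2)))"
proof -
  interpret dec_polyak_seg_setup M \<F> n b S 1 c \<gamma>_init \<gamma> by fact
  define Gi where "Gi i = (if i \<in> {1..n} then Fi i else (\<lambda>_. 0))" for i
  have batch_Gi: "batch_mean Gi s = batch_mean Fi s" if "s \<in> set_pmf (minibatch_pmf n b)" for s
  proof -
    have "(\<Sum>i\<leftarrow>s. Gi i z) = (\<Sum>i\<leftarrow>s. Fi i z)" for z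
      using set_minibatch_pmfD[OF n_pos that]
      by (intro arg_cong[where f=sum_list] map_cong) (auto simp: Gi_def)
    then show ?thesis by (simp add: batch_mean_def fun_eq_iff)
  qed
  define y where "y k \<omega> = seg_iterate (\<lambda>j. batch_mean Gi (S j \<omega>)) (\<lambda>j. \<gamma> j \<omega>) x0 k" for k \<omega>
  define yh where "yh k \<omega> = seg_extrapolated (\<lambda>j. batch_mean Gi (S j \<omega>)) (\<lambda>j. \<gamma> j \<omega>) x0 k" for k \<omega>
  define \<beta> where "\<beta> k \<omega> = seg_alpha (\<lambda>j. batch_mean Gi (S j \<omega>)) (\<lambda>j. \<gamma> j \<omega>) x0 k" for k \<omega>
  have same: "AE \<omega> in M. \<forall>k. batch_mean Gi (S k \<omega>) = batch_mean Fi (S k \<omega>)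
      \<and> y k \<omega> = x k \<omega> \<and> yh k \<omega> = xh k \<omega> \<and> \<beta> k \<omega> = \<alpha> k \<omega>"
    using AE_batch_in_support
  proof eventually_elim
    case (elim \<omega>)
    then have "batch_mean Gi (S k \<omega>) = batch_mean Fi (S k \<omega>)" for k
      by (simp add: batch_Gi)
    then show ?case
      by (simp add: y_def yh_def \<beta>_def x_eq xh_eq alpha_eq)
  qed
  interpret run: confined_seg_run M \<F> n b S c \<gamma>_init \<gamma> Gi F L A C xstar x0 y yh \<beta>
  proof
    show "F z = (1 / real n) *\<^sub>R (\<Sum>i=1..n. Gi i z)" for z
      by (simp add: F_eq Gi_def)
    show "L-lipschitz_on UNIV (Gi i)" for i
      using Fi_lipschitz[of i] L_pos by (auto simp: Gi_def lipschitz_on_def)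
    show "AE \<omega> in M. \<forall>k. norm (batch_mean Gi (S k \<omega>) (yh k \<omega>) - batch_mean Gi (S k \<omega>) (y k \<omega>))
        \<le> A * norm (batch_mean Gi (S k \<omega>) (y k \<omega>))"
      using critical same by eventually_elim simp
    show "AE \<omega> in M. \<forall>k. y k \<omega> \<in> C \<and> yh k \<omega> \<in> C"
      using run_in_C same by eventually_elim simp
  qed (fact y_def yh_def \<beta>_def L_pos F_monotone A_range C_compact C_convex zero)+
  have "measure_pmf.expectation (minibatch_pmf n b) (\<lambda>s. (norm (batch_mean Gi s xstar))\<^sup>2)
      = measure_pmf.expectation (minibatch_pmf n b) (\<lambda>s. (norm (batch_mean Fi s xstar))\<^sup>2)"
    by (intro integral_cong_AE) (auto simp: AE_measure_pmf_iff batch_Gi)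
  then have variance: "\<sigma>\<^sup>2 = run.variance_bound"
    by (simp add: sigma_sq run.variance_bound_def D_eq power_mult_distrib)
  have lhs: "(\<integral>\<^sup>+ \<omega>. ennreal ((norm (F ((1 / (real K + 1)) *\<^sub>R (\<Sum>k\<le>K. yh k \<omega>))))\<^sup>2) \<partial>M)
      = (\<integral>\<^sup>+ \<omega>. ennreal ((norm (F ((1 / (real K + 1)) *\<^sub>R (\<Sum>k=0..K. xh k \<omega>))))\<^sup>2) \<partial>M)"
    using same by (intro nn_integral_cong_AE) (auto elim!: eventually_mono simp: atMost_atLeast0)
  have rhs: "(\<integral>\<^sup>+ \<omega>. ennreal (9 * D\<^sup>2 / (8 * \<beta> K \<omega>)) \<partial>M) = (\<integral>\<^sup>+ \<omega>. ennreal (9 * D\<^sup>2 / (8 * \<alpha> K \<omega>)) \<partial>M)"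
    using same by (intro nn_integral_cong_AE) (auto elim!: eventually_mono)
  show ?thesis
    using run.residual_rate[OF c_eq gamma_init_pos A_range(1) sigma_nonneg variance, of K]
    unfolding D_eq[symmetric] lhs rhs .
qed

end
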